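(* Let $g\in L^1(\mathbb{R}^d)\cap L^2(\mathbb{R}^d)\cap C^1(\mathbb{R}^d)$ be such that $\mathrm{supp}(\hat g)$ is compact and connected, $|\hat g(0)|=1$, and $\sum_{m\in\mathbb{Z}^d}|\hat g(\xi-m)|^2=1$ for all $\xi\in\mathbb{R}^d$. Let $A\colon\mathbb{R}^d\to\mathbb{R}^d$ be an invertible linear transformation, $f_0(x)=|\det A|\,g(Ax)$, $\mathcal{P}=A^t\mathbb{Z}^d\setminus\{0\}$, and $f_p(x)=e^{2\pi ip\cdot x}f_0(x)$ for each $p\in\mathcal{P}$. Then $\mathcal{F}=\{f_0\}\cup\{f_p\colon p\in\mathcal{P}\}$ is a (semi-discrete) Gabor frame, as well as a uniform covering frame.
   Context: Fourier transform: $\hat f(\xi)=\int_{\mathbb{R}^d}f(x)e^{-2\pi i x\cdot\xi}\,dx$. $A^t$ is the transpose of $A$. $|y|_\infty$ is the sup norm, and $Q_R(x)=\{y\in\mathbb{R}^d\colon |y-x|_\infty<R\}$ is the open cube of side length $2R$ centered at $x$. Supports are essential supports (complement of the largest open set where the function vanishes a.e.). Uniform covering frame: Let $\mathcal{P}$ be a countably infinite index set. A uniform covering frame is a family of functions $\mathcal{F}=\{f_0\}\cup\{f_p\colon p\in\mathcal{P}\}$ such that: (i) $f_0\in L^1(\mathbb{R}^d)\cap L^2(\mathbb{R}^d)\cap C^1(\mathbb{R}^d)$, $\hat f_0$ is supported in a compact neighborhood of the origin, and $|\hat f_0(0)|=1$; for each $p\in\mathcal{P}$, $f_p\in L^1(\mathbb{R}^d)\cap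 L^2(\mathbb{R}^d)$ and $\mathrm{supp}(\hat f_p)$ is compact and connected. (ii) (Uniform covering property) For any $R>0$ there is an integer $N>0$ such that for each $p\in\mathcal{P}$ the set $\mathrm{supp}(\hat f_p)$ can be covered by $N$ cubes of side length $2R$ (of the form $Q_R(x)$). (iii) (Frame condition) $|\hat f_0(\xi)|^2+\sum_{p\in\mathcal{P}}|\hat f_p(\xi)|^2=1$ for all $\xi\in\mathbb{R}^d$; this implies that $\mathcal{F}$ is a semi-discrete Parseval frame, i.e. $\|f*f_0\|_{L^2}^2+\sum_{p\in\mathcal{P}}\|f*f_p\|_{L^2}^2=\|f\|_{L^2}^2$ for all $f\in L^2(\mathbb{R}^d)$. A (semi-discrete) Gabor frame here means a semi-discrete (Parseval) frame for $L^2(\mathbb{R}^d)$, in the sense of the last displayed identity, whose elements are the modulations $e^{2\pi ip\cdot x}f_0(x)$ of a single window $f_0$ by the points $p$ of a lattice in $\mathbb{R}^d$. *)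

theory Defs
  imports "HOL-Analysis.Analysis"
begin

definition in_L1 :: "(real ^ 'n \<Rightarrow> complex) \<Rightarrow> bool" where
  "in_L1 f \<longleftrightarrow> integrable lebesgue f"

definition in_L2 :: "(real ^ 'n \<Rightarrow> complex) \<Rightarrow> bool" where
  "in_L2 f \<longleftrightarrow> f \<in> borel_measurable lebesgue \<and> integrable lebesgue (\<lambda>x. (cmod (f x))\<^sup>2)"

definition L2_norm :: "(real ^ 'n \<Rightarrow> complex) \<Rightarrow> real" where
  "L2_norm f = sqrt (LINT x|lebesgue. (cmod (f x))\<^sup>2)"

definition in_C1 :: "(real ^ 'n \<Rightarrow> complex) \<Rightarrow> bool" where
  "in_C1 f \<longleftrightarrow> (\<exists>f' :: real ^ 'n \<Rightarrow> (real ^ 'n) \<Rightarrow>\<^sub>L complex.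
     (\<forall>x. (f has_derivative blinfun_apply (f' x)) (at x)) \<and> continuous_on UNIV f')"

definition fourier :: "(real ^ 'n \<Rightarrow> complex) \<Rightarrow> real ^ 'n \<Rightarrow> complex" where
  "fourier f \<xi> = (LINT x|lebesgue. f x * cis (- 2 * pi * (x \<bullet> \<xi>)))"

definition conv :: "(real ^ 'n \<Rightarrow> complex) \<Rightarrow> (real ^ 'n \<Rightarrow> complex) \<Rightarrow> real ^ 'n \<Rightarrow> complex" where
  "conv f h x = (LINT y|lebesgue. f y * h (x - y))"

definition modulation :: "real ^ 'n \<Rightarrow> (real ^ 'n \<Rightarrow> complex) \<Rightarrow> real ^ 'n \<Rightarrow> complex" where
  "modulation p h x = cis (2 * pi * (p \<bullet> x)) * h x"

definition ess_support :: "(real ^ 'n \<Rightarrow> complex) \<Rightarrow> (real ^ 'n) set" where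
  "ess_support f = - \<Union> {U. open U \<and> (AE x in lebesgue. x \<in> U \<longrightarrow> f x = 0)}"

definition cube :: "real \<Rightarrow> real ^ 'n \<Rightarrow> (real ^ 'n) set" where
  "cube R x = {y. infnorm (y - x) < R}"

definition int_lattice :: "(real ^ 'n) set" where
  "int_lattice = {m. \<forall>i. m $ i \<in> \<int>}"

text \<open>Lattices have full rank: they are the integer spans of the bases of the whole space.\<close>

definition is_lattice :: "(real ^ 'n) set \<Rightarrow> bool" where
  "is_lattice \<Lambda> \<longleftrightarrow> (\<exists>B. independent B \<and> span B = UNIV \<and>
     \<Lambda> = range (\<lambda>c :: real ^ 'n \<Rightarrow> int. \<Sum>b\<in>B. of_int (c b) *\<^sub>R b))"

text \<open>A family consisting of one function \<open>f0\<close> and functions \<open>f p\<close> for \<open>p \<in> P\<close> is given by the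
  triple \<open>f0\<close>, \<open>P\<close>, \<open>f\<close>; values of \<open>f\<close> outside \<open>P\<close> are irrelevant.

  The Bochner integral of a non-integrable function is 0 by convention.  The frame identity
  is therefore accompanied by the requirement that the convolutions exist almost everywhere
  and belong to $L^2$.\<close>

definition conv_in_L2 :: "(real ^ 'n \<Rightarrow> complex) \<Rightarrow> (real ^ 'n \<Rightarrow> complex) \<Rightarrow> bool" where
  "conv_in_L2 f h \<longleftrightarrow>
     (AE x in lebesgue. integrable lebesgue (\<lambda>y. f y * h (x - y))) \<and> in_L2 (conv f h)"

definition semidiscrete_parseval_frame ::
  "(real ^ 'n \<Rightarrow> complex) \<Rightarrow> 'p set \<Rightarrow> ('p \<Rightarrow> real ^ 'n \<Rightarrow> complex) \<Rightarrow> bool" where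
  "semidiscrete_parseval_frame f0 P f \<longleftrightarrow> (\<forall>h. in_L2 h \<longrightarrow>
     conv_in_L2 h f0 \<and> (\<forall>p\<in>P. conv_in_L2 h (f p)) \<and>
     (\<lambda>p. (L2_norm (conv h (f p)))\<^sup>2) summable_on P \<and>
     (L2_norm (conv h f0))\<^sup>2 + (\<Sum>\<^sub>\<infinity>p\<in>P. (L2_norm (conv h (f p)))\<^sup>2) = (L2_norm h)\<^sup>2)"

text \<open>The window \<open>f0\<close> is its own modulation by the lattice point 0, so the remaining members of
  the family are indexed by the nonzero lattice points.\<close>

definition gabor_frame ::
  "(real ^ 'n \<Rightarrow> complex) \<Rightarrow> (real ^ 'n) set \<Rightarrow> (real ^ 'n \<Rightarrow> real ^ 'n \<Rightarrow> complex) \<Rightarrow> bool" where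
  "gabor_frame f0 P f \<longleftrightarrow>
     (\<exists>\<Lambda>. is_lattice \<Lambda> \<and> P = \<Lambda> - {0}) \<and>
     (\<forall>p\<in>P. f p = modulation p f0) \<and>
     semidiscrete_parseval_frame f0 P f"

definition uniform_covering_property ::
  "'p set \<Rightarrow> ('p \<Rightarrow> real ^ 'n \<Rightarrow> complex) \<Rightarrow> bool" where
  "uniform_covering_property P f \<longleftrightarrow> (\<forall>R>0. \<exists>N::nat. N > 0 \<and>
     (\<forall>p\<in>P. \<exists>x :: nat \<Rightarrow> real ^ 'n. ess_support (fourier (f p)) \<subseteq> (\<Union>i<N. cube R (x i))))"

definition frame_condition ::
  "(real ^ 'n \<Rightarrow> complex) \<Rightarrow> 'p set \<Rightarrow> ('p \<Rightarrow> real ^ 'n \<Rightarrow> complex) \<Rightarrow> bool" where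
  "frame_condition f0 P f \<longleftrightarrow> (\<forall>\<xi>.
     (\<lambda>p. (cmod (fourier (f p) \<xi>))\<^sup>2) summable_on P \<and>
     (cmod (fourier f0 \<xi>))\<^sup>2 + (\<Sum>\<^sub>\<infinity>p\<in>P. (cmod (fourier (f p) \<xi>))\<^sup>2) = 1)"

definition uniform_covering_frame ::
  "(real ^ 'n \<Rightarrow> complex) \<Rightarrow> 'p set \<Rightarrow> ('p \<Rightarrow> real ^ 'n \<Rightarrow> complex) \<Rightarrow> bool" where
  "uniform_covering_frame f0 P f \<longleftrightarrow>
     countable P \<and> infinite P \<and>
     in_L1 f0 \<and> in_L2 f0 \<and> in_C1 f0 \<and>
     (\<exists>K. compact K \<and> 0 \<in> interior K \<and> ess_support (fourier f0) \<subseteq> K) \<and>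
     cmod (fourier f0 0) = 1 \<and>
     (\<forall>p\<in>P. in_L1 (f p) \<and> in_L2 (f p) \<and>
        compact (ess_support (fourier (f p))) \<and> connected (ess_support (fourier (f p)))) \<and>
     uniform_covering_property P f \<and>
     frame_condition f0 P f"

end

(* The modulations of f0 have Fourier transforms fhat_0(xi - p), and fhat_0(A^t eta) = ghat(eta), so
   the partition of unity for g over the integer lattice becomes one for f0 over A^t Z^d; translating
   one compact support gives the covering property with a number of cubes that does not depend on p.
   For the Parseval identity, Plancherel's theorem is needed only for bounded integrable functions,
   where Gaussian regularisation and continuity of translations in L^1 suffice: for such h,
   sum_p |h * f_p|^2 = int |hhat|^2 sum_p |fhat_p|^2 = |h|^2, and truncation extends this to all of L^2. *)

theory Submission
  imports Defs "HOL-Probability.Probability"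
begin

subsection \<open>Linear change of variables\<close>

text \<open>For \<open>h\<close> in L^2 but not in L^1 the integral \<open>fourier h\<close> is the
  default 0 at every frequency, so the identity with \<open>fourier h\<close> on the right fails for
  such \<open>h\<close>. The frequency argument is therefore confined to bounded integrable
  \<open>h\<close>: there \<open>conv h (f p)\<close> is integrable as a convolution of L^1
  functions and bounded as a convolution of L^2 functions, hence again within the scope of the
  restricted Plancherel theorem. The passage to L^2 takes place on the space side, where
  convolutions with truncations converge pointwise. Fatou's lemma, applied to the energy of the
  whole family, gives the upper bound, and a weighted inequality for |a - b|^2 converts the upper
  bound for the tails into the lower bound. Sums over indices are integrals against counting measure
  with values in [0, \<infinity>]; Tonelli then exchanges them with integrals, and summability is
  read off at the end from a finite total. The definitions speak of \<open>lebesgue\<close>, while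
  product measures are formed from \<open>lborel\<close>; the analysis is done for Borel functions,
  and an L^2 function is replaced by a Borel version, which changes its convolutions at no
  point.\<close>

lemma det_matrix_shear:
  fixes m n :: "'n::finite"
  assumes "m \<noteq> n"
  shows "det (matrix (\<lambda>x :: real^'n. \<chi> i. if i = m then x $ m + x $ n else x $ i)) = 1"
proof -
  have "matrix (\<lambda>x :: real^'n. \<chi> i. if i = m then x $ m + x $ n else x $ i)
      = (\<chi> k. if k = m then row m (mat 1) + 1 *s row n (mat 1) else row k (mat 1))"
    using assms by (auto simp: matrix_def vec_eq_iff row_def mat_def axis_def)
  then show ?thesis
    using det_row_operation[OF assms, of "mat 1" 1] by simp
qed

text \<open>The matrix is the identity with two columns exchanged (or the identity itself when
  \<open>m = n\<close>), so its determinant is the sign of a permutation.\<close>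

lemma det_matrix_swap:
  fixes m n :: "'n::finite"
  shows "\<bar>det (matrix (\<lambda>x :: real^'n. \<chi> i. x $ Transposition.transpose m n i))\<bar> = 1"
proof -
  have "(\<chi> i j. if Transposition.transpose m n i = j then 1 else 0)
      = (\<chi> i j. if j = Transposition.transpose m n i then 1 else (0::real))"
    by (auto intro!: Cart_lambda_cong)
  then have "matrix (\<lambda>x :: real^'n. \<chi> i. x $ Transposition.transpose m n i)
      = Finite_Cartesian_Product.transpose (\<chi> i j. mat 1 $ i $ Transposition.transpose m n j)"
    by (auto simp: matrix_eq Finite_Cartesian_Product.transpose_def axis_def mat_def matrix_def)
  then show ?thesis
    by (simp add: det_permute_columns permutes_swap_id sign_swap_id abs_mult)
qed

text \<open>\<open>measure_shear_interval\<close> wants a nonempty box with nonnegative lower bound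
  in coordinate \<open>n\<close>. Translating by \<open>?v\<close> makes that bound 0; the shear
  copies this shift into coordinate \<open>m\<close>, so \<open>?w\<close> has to undo it in both
  coordinates.\<close>

lemma measure_shear_cbox:
  fixes a b :: "real^'n"
  assumes "m \<noteq> n"
  shows "measure lebesgue ((\<lambda>x. \<chi> i. if i = m then x $ m + x $ n else x $ i) ` cbox a b)
       = measure lebesgue (cbox a b)" (is "measure lebesgue (?h ` _) = _")
proof (cases "cbox a b = {}")
  case False
  let ?v = "axis n (- a $ n)" and ?w = "axis m (a $ n) + axis n (a $ n)"
  have eq: "?h ` cbox a b = (+) ?w ` ?h ` cbox (?v + a) (?v + b)"
  proof -
    have "?h x = ?w + ?h (?v + x)" for x
      unfolding vec_eq_iff
    proof
      show "?h x $ i = (?w + ?h (?v + x)) $ i" for i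
        using assms by (cases "i = m"; cases "i = n") (auto simp: axis_def)
    qed
    then show ?thesis
      unfolding cbox_translation image_image by (intro image_cong refl)
  qed
  have "cbox (?v + a) (?v + b) \<noteq> {}"
    using False by (simp add: cbox_translation)
  then have "measure lebesgue (?h ` cbox (?v + a) (?v + b)) = measure lebesgue (cbox (?v + a) (?v + b))"
    using assms by (intro measure_shear_interval) auto
  moreover have "measure lebesgue (cbox (?v + a) (?v + b)) = measure lebesgue (cbox a b)"
    unfolding cbox_translation by (rule measure_translation)
  ultimately show ?thesis
    unfolding eq by (simp only: measure_translation)
qed simp

lemma vimage_eq_image_of_inverse:
  assumes "\<And>x. h (k x) = x" and "\<And>x. k (h x) = x"
  shows "h -` S = k ` S"
  by (auto simp: assms intro!: image_eqI[where x = "h _"])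

lemma lborel_distr_shear:
  fixes m n :: "'n::finite"
  assumes "m \<noteq> n"
  shows "distr lborel borel (\<lambda>x :: real^'n. \<chi> i. if i = m then x $ m + x $ n else x $ i) = lborel"
    (is "distr _ _ ?h = _")
proof (rule sym, rule lborel_eqI)
  let ?k = "\<lambda>x :: real^'n. \<chi> i. if i = m then x $ m - x $ n else x $ i"
  have lin: "linear ?h" "linear ?k"
    by (auto intro!: linearI simp: algebra_simps vec_eq_iff)
  have hk: "?h (?k x) = x" "?k (?h x) = x" for x
    using assms by (auto simp: vec_eq_iff)
  have hm: "?h \<in> borel_measurable borel"
    using lin(1) by (simp add: borel_measurable_continuous_onI linear_continuous_on linear_conv_bounded_linear)
  fix l u :: "real^'n" assume le: "\<And>b. b \<in> Basis \<Longrightarrow> l \<bullet> b \<le> u \<bullet> b"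
  have vi: "?h -` box l u = ?k ` box l u"
    by (rule vimage_eq_image_of_inverse) (fact hk)+
  have bdd: "bounded (?k ` box l u)"
    using lin(2) by (simp add: bounded_linear_image linear_conv_bounded_linear)
  have S: "?k ` box l u \<in> sets borel"
    unfolding vi[symmetric] using measurable_sets[OF hm, of "box l u"] by simp
  have lm: "?k ` box l u \<in> lmeasurable"
    using bdd S by (intro bounded_set_imp_lmeasurable) auto
  \<comment> \<open>\<open>measure_linear_sufficient\<close> lifts volume preservation from closed
    boxes to measurable sets. It is used on the preimage of \<open>box l u\<close>, whose image
    under the shear is the box itself.\<close>
  have "1 * measure lebesgue (?k ` box l u) = measure lebesgue (?h ` ?k ` box l u)"
    using measure_linear_sufficient[OF lin(1) lm, of 1] measure_shear_cbox[OF assms] by simp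
  then have "measure lebesgue (?k ` box l u) = measure lebesgue (box l u)"
    by (simp add: image_image hk)
  then have "emeasure lborel (?k ` box l u) = emeasure lborel (box l u)"
    using emeasure_eq_measure2[OF lm] emeasure_eq_measure2[of "box l u" lebesgue] S by simp
  then show "emeasure (distr lborel borel ?h) (box l u) = (\<Prod>b\<in>Basis. (u - l) \<bullet> b)"
    using le by (simp add: emeasure_distr hm vi emeasure_lborel_box)
qed simp

text \<open>The preimage of a box is a box with two sides exchanged, and its volume is a product
  over all coordinates.\<close>

lemma lborel_distr_swap:
  fixes m n :: "'n::finite"
  shows "distr lborel borel (\<lambda>x :: real^'n. \<chi> i. x $ Transposition.transpose m n i) = lborel"
    (is "distr _ _ ?h = _")
proof (rule sym, rule lborel_eqI)
  have lin: "linear ?h"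
    by (auto intro!: linearI simp: vec_eq_iff)
  have hm: "?h \<in> borel_measurable borel"
    using lin by (simp add: borel_measurable_continuous_onI linear_continuous_on linear_conv_bounded_linear)
  fix l u :: "real^'n" assume le: "\<And>b. b \<in> Basis \<Longrightarrow> l \<bullet> b \<le> u \<bullet> b"
  have leb: "l $ i \<le> u $ i" for i
    using le[of "axis i 1"] by (simp add: inner_axis)
  have vi: "?h -` box l u = box (?h l) (?h u)"
    by (auto simp: mem_box_cart) (metis transpose_involutory)+
  have pr: "(\<Prod>b\<in>Basis. (v :: real^'n) \<bullet> b) = (\<Prod>i\<in>UNIV. v $ i)" for v
    unfolding Basis_vec_def by (subst prod.UNION_disjoint) (auto simp: inner_axis axis_eq_axis)
  have "(\<Prod>i\<in>UNIV. ?h u $ i - ?h l $ i) = (\<Prod>i\<in>UNIV. u $ i - l $ i)"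
    using prod.permute[OF permutes_swap_id, of m UNIV n "\<lambda>i. u $ i - l $ i"] by (simp add: o_def)
  moreover have "\<And>b. b \<in> Basis \<Longrightarrow> ?h l \<bullet> b \<le> ?h u \<bullet> b"
    using leb by (auto simp: Basis_vec_def inner_axis)
  ultimately show "emeasure (distr lborel borel ?h) (box l u) = (\<Prod>b\<in>Basis. (u - l) \<bullet> b)"
    by (simp add: emeasure_distr hm vi emeasure_lborel_box pr del: Basis_vec_def)
qed simp

lemma borel_measurable_linear:
  fixes f :: "'a::euclidean_space \<Rightarrow> 'b::euclidean_space"
  shows "linear f \<Longrightarrow> f \<in> borel_measurable borel"
  by (simp add: borel_measurable_continuous_onI linear_continuous_on linear_conv_bounded_linear)

text \<open>The library has this change of variables only for well-ordered index types.\<close>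

theorem lborel_linear:
  fixes f :: "real^'n \<Rightarrow> real^'n"
  assumes "linear f" and "det (matrix f) \<noteq> 0"
  shows "lborel = density (distr lborel borel f) (\<lambda>_. ennreal \<bar>det (matrix f)\<bar>)"
proof -
  \<comment> \<open>The determinant condition moves into the claim because the induction also runs
    through singular maps, for which the implication is vacuous.\<close>
  have "det (matrix f) \<noteq> 0 \<longrightarrow> lborel = density (distr lborel borel f) (\<lambda>_. ennreal \<bar>det (matrix f)\<bar>)"
  proof (rule induct_linear_elementary[OF \<open>linear f\<close>])
    fix f g :: "real^'n \<Rightarrow> real^'n"
    let ?d = "\<lambda>f :: real^'n \<Rightarrow> real^'n. ennreal \<bar>det (matrix f)\<bar>"
    assume lin: "linear f" "linear g"
      and f: "det (matrix f) \<noteq> 0 \<longrightarrow> lborel = density (distr lborel borel f) (\<lambda>_. ?d f)"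
      and g: "det (matrix g) \<noteq> 0 \<longrightarrow> lborel = density (distr lborel borel g) (\<lambda>_. ?d g)"
    note [measurable] = lin[THEN borel_measurable_linear]
    have d: "det (matrix (f \<circ> g)) = det (matrix f) * det (matrix g)"
      by (simp add: matrix_compose lin det_mul)
    show "det (matrix (f \<circ> g)) \<noteq> 0 \<longrightarrow> lborel = density (distr lborel borel (f \<circ> g)) (\<lambda>_. ?d (f \<circ> g))"
    proof
      assume "det (matrix (f \<circ> g)) \<noteq> 0"
      then have "lborel = density (distr lborel borel f) (\<lambda>_. ?d f)"
        using f d by simp
      also have "\<dots> = density (distr (density (distr lborel borel g) (\<lambda>_. ?d g)) borel f) (\<lambda>_. ?d f)"
        using g d \<open>det (matrix (f \<circ> g)) \<noteq> 0\<close> by simp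
      also have "distr (density (distr lborel borel g) (\<lambda>_. ?d g)) borel f
          = density (distr (distr lborel borel g) borel f) (\<lambda>_. ?d g)"
        by (rule measure_eqI) (auto simp: emeasure_distr emeasure_density_const measurable_sets_borel[of f borel])
      also have "distr (distr lborel borel g) borel f = distr lborel borel (f \<circ> g)"
        by (simp add: distr_distr)
      finally show "lborel = density (distr lborel borel (f \<circ> g)) (\<lambda>_. ?d (f \<circ> g))"
        by (simp add: density_density_eq d abs_mult ennreal_mult mult.commute)
    qed
  next
    fix f :: "real^'n \<Rightarrow> real^'n" and i
    assume "linear f" and 0: "\<And>x. f x $ i = 0"
    then have "\<not> surj f"
      by (metis one_neq_zero surjE vec_component)
    then have "\<not> inj f"
      using \<open>linear f\<close> linear_injective_imp_surjective by blast
    then show "det (matrix f) \<noteq> 0 \<longrightarrow> lborel = density (distr lborel borel f) (\<lambda>_. ennreal \<bar>det (matrix f)\<bar>)"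
      using det_nz_iff_inj[OF \<open>linear f\<close>] by blast
  next
    fix c :: "'n \<Rightarrow> real"
    let ?h = "\<lambda>x. \<chi> i. c i * x $ i"
    have d: "det (matrix ?h) = (\<Prod>i\<in>UNIV. c i)"
      by (subst det_diagonal) (auto simp: matrix_def axis_def)
    \<comment> \<open>\<open>c'\<close> is \<open>c\<close> reindexed by basis vectors, the form in
      which \<open>lborel_affine_euclidean\<close> takes its scaling factors.\<close>
    define c' where "c' j = (\<Sum>i\<in>UNIV. c i * (j $ i))" for j :: "real^'n"
    have c': "c' (axis i 1) = c i" for i
      by (simp add: c'_def axis_def if_distrib cong: if_cong)
    have h: "?h x = 0 + (\<Sum>j\<in>Basis. (c' j * (x \<bullet> j)) *\<^sub>R j)" for x
    proof -
      have "(\<Sum>j\<in>Basis. (c' j * (x \<bullet> j)) *\<^sub>R j) = (\<Sum>i\<in>UNIV. (c i * x $ i) *\<^sub>R axis i 1)"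
        unfolding Basis_vec_def
        by (subst sum.UNION_disjoint) (auto simp: axis_eq_axis inner_axis c')
      also have "\<dots> = ?h x"
        by (simp add: vec_eq_iff axis_def if_distrib cong: if_cong)
      finally show ?thesis by simp
    qed
    have p: "(\<Prod>j\<in>Basis. \<bar>c' j\<bar>) = \<bar>\<Prod>i\<in>UNIV. c i\<bar>"
      unfolding Basis_vec_def
      by (subst prod.UNION_disjoint) (auto simp: axis_eq_axis c' abs_prod)
    show "det (matrix ?h) \<noteq> 0 \<longrightarrow> lborel = density (distr lborel borel ?h) (\<lambda>_. ennreal \<bar>det (matrix ?h)\<bar>)"
    proof
      assume "det (matrix ?h) \<noteq> 0"
      then have "c' j \<noteq> 0" if "j \<in> Basis" for j
        using that d by (auto simp: Basis_vec_def c')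
      from lborel_affine_euclidean[of c' 0, OF this]
      have "lborel = density (distr lborel borel ?h) (\<lambda>_. ennreal (\<Prod>j\<in>Basis. \<bar>c' j\<bar>))"
        unfolding h .
      then show "lborel = density (distr lborel borel ?h) (\<lambda>_. ennreal \<bar>det (matrix ?h)\<bar>)"
        unfolding p d .
    qed
  next
    fix m n :: 'n assume "m \<noteq> n"
    let ?h = "\<lambda>x :: real^'n. \<chi> i. x $ Transposition.transpose m n i"
    show "det (matrix ?h) \<noteq> 0 \<longrightarrow> lborel = density (distr lborel borel ?h) (\<lambda>_. ennreal \<bar>det (matrix ?h)\<bar>)"
      unfolding det_matrix_swap lborel_distr_swap by (simp add: density_1)
  next
    fix m n :: 'n assume "m \<noteq> n"
    let ?h = "\<lambda>x :: real^'n. \<chi> i. if i = m then x $ m + x $ n else x $ i"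
    show "det (matrix ?h) \<noteq> 0 \<longrightarrow> lborel = density (distr lborel borel ?h) (\<lambda>_. ennreal \<bar>det (matrix ?h)\<bar>)"
      unfolding det_matrix_shear[OF \<open>m \<noteq> n\<close>] lborel_distr_shear[OF \<open>m \<noteq> n\<close>] by (simp add: density_1)
  qed
  then show ?thesis
    using assms by blast
qed

lemma
  fixes f :: "real^'n \<Rightarrow> real^'n" and u :: "real^'n \<Rightarrow> 'b::{banach, second_countable_topology}"
  assumes "linear f" and "det (matrix f) \<noteq> 0" and [measurable]: "u \<in> borel_measurable borel"
  shows integral_lborel_linear: "(LINT x|lborel. u x) = \<bar>det (matrix f)\<bar> *\<^sub>R (LINT x|lborel. u (f x))"
    and integrable_lborel_linear: "integrable lborel (\<lambda>x. u (f x)) \<longleftrightarrow> integrable lborel u"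
proof -
  note [measurable] = borel_measurable_linear[OF assms(1)]
  show "(LINT x|lborel. u x) = \<bar>det (matrix f)\<bar> *\<^sub>R (LINT x|lborel. u (f x))"
    by (subst lborel_linear[OF assms(1,2)]) (simp add: integral_density integral_distr)
  show "integrable lborel (\<lambda>x. u (f x)) \<longleftrightarrow> integrable lborel u"
    using assms(2) by (subst (2) lborel_linear[OF assms(1,2)])
      (use integrable_scaleR_right[of "inverse \<bar>det (matrix f)\<bar>" lborel
          "\<lambda>x. \<bar>det (matrix f)\<bar> *\<^sub>R u (f x)"] in
        \<open>auto simp: integrable_density integrable_distr_eq\<close>)
qed

subsection \<open>Gaussian integrals and translations\<close>

lemma borel_measurable_cis[measurable (raw)]:
  "f \<in> borel_measurable M \<Longrightarrow> (\<lambda>x. cis (f x)) \<in> borel_measurable M"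
  by (rule measurable_compose[where g = cis]) (auto intro!: borel_measurable_continuous_onI continuous_intros)

text \<open>Fubini for tensor products: \<open>lborel\<close> is the image of the product of
  one-dimensional Lebesgue measures under the map \<open>?S\<close> that assembles a vector from its
  coordinates.\<close>

lemma
  fixes f :: "'a::euclidean_space \<Rightarrow> real \<Rightarrow> complex"
  assumes f: "\<And>b. b \<in> Basis \<Longrightarrow> integrable lborel (f b)"
  shows integrable_lborel_prod: "integrable lborel (\<lambda>x. \<Prod>b\<in>Basis. f b (x \<bullet> b))"
    and integral_lborel_prod:
      "(LINT x|lborel. (\<Prod>b\<in>Basis. f b (x \<bullet> b))) = (\<Prod>b\<in>Basis. LINT x|lborel. f b x)"
proof -
  interpret product_sigma_finite "\<lambda>_ :: 'a. lborel :: real measure"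
    by standard
  let ?S = "\<lambda>g. \<Sum>b\<in>Basis. g b *\<^sub>R b :: 'a"
  have [measurable]: "b \<in> Basis \<Longrightarrow> f b \<in> borel_measurable borel" for b
    using f[of b] by auto
  have S: "(\<Prod>b\<in>Basis. f b (?S g \<bullet> b)) = (\<Prod>b\<in>Basis. f b (g b))" for g
    by (intro prod.cong) auto
  show "integrable lborel (\<lambda>x. \<Prod>b\<in>Basis. f b (x \<bullet> b))"
    using product_integrable_prod[OF finite_Basis, of f] f
    by (subst lborel_eq, subst integrable_distr_eq) (simp_all add: S)
  show "(LINT x|lborel. (\<Prod>b\<in>Basis. f b (x \<bullet> b))) = (\<Prod>b\<in>Basis. LINT x|lborel. f b x)"
    using product_integral_prod[OF finite_Basis, of f] f
    by (subst lborel_eq, subst integral_distr) (simp_all add: S)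
qed

text \<open>Up to the normalisation \<open>sqrt (2 * pi)\<close> this is the characteristic function
  of the standard normal distribution.\<close>

lemma
  fixes t :: real
  shows integrable_gaussian_1d: "integrable lborel (\<lambda>x. complex_of_real (exp (- (x\<^sup>2 / 2))) * cis (t * x))"
    and integral_gaussian_1d:
      "(LINT x|lborel. complex_of_real (exp (- (x\<^sup>2 / 2))) * cis (t * x)) = sqrt (2 * pi) * exp (- (t\<^sup>2 / 2))"
proof -
  have int: "integrable lborel std_normal_density"
    by simp
  show "integrable lborel (\<lambda>x. complex_of_real (exp (- (x\<^sup>2 / 2))) * cis (t * x))"
  proof (rule Bochner_Integration.integrable_bound)
    show "integrable lborel (\<lambda>x. sqrt (2 * pi) * std_normal_density x)"
      using int by simp
    show "AE x in lborel. norm (complex_of_real (exp (- (x\<^sup>2 / 2))) * cis (t * x)) \<le> norm (sqrt (2 * pi) * std_normal_density x)"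
      by (simp add: norm_mult std_normal_density_def)
  qed simp
  have "(LINT x|lborel. complex_of_real (exp (- (x\<^sup>2 / 2))) * cis (t * x))
      = complex_of_real (sqrt (2 * pi)) * (LINT x|lborel. std_normal_density x *\<^sub>R iexp (t * x))"
    by (subst integral_mult_right_zero[symmetric], intro Bochner_Integration.integral_cong)
       (auto simp: std_normal_density_def cis_conv_exp scaleR_conv_of_real)
  also have "\<dots> = sqrt (2 * pi) * char std_normal_distribution t"
    by (simp add: char_def integral_density)
  finally show "(LINT x|lborel. complex_of_real (exp (- (x\<^sup>2 / 2))) * cis (t * x)) = sqrt (2 * pi) * exp (- (t\<^sup>2 / 2))"
    by (simp add: char_std_normal_distribution)
qed

text \<open>Both the squared norm and the inner product are sums over coordinates, so the integrand
  is a tensor product of the one-dimensional ones.\<close>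

lemma
  fixes t :: "'a::euclidean_space"
  shows integrable_gaussian:
      "integrable lborel (\<lambda>x. complex_of_real (exp (- ((norm x)\<^sup>2 / 2))) * cis (t \<bullet> x))"
    and integral_gaussian:
      "(LINT x|lborel. complex_of_real (exp (- ((norm x)\<^sup>2 / 2))) * cis (t \<bullet> x))
        = sqrt (2 * pi) ^ DIM('a) * exp (- ((norm t)\<^sup>2 / 2))"
proof -
  have nrm: "(norm y)\<^sup>2 = (\<Sum>b\<in>Basis. (y \<bullet> b)\<^sup>2)" for y :: 'a
    by (subst norm_eq_sqrt_inner, subst euclidean_inner) (simp add: power2_eq_square sum_nonneg)
  have cs: "cis (\<Sum>b\<in>B. u b) = (\<Prod>b\<in>B. cis (u b))" if "finite B" for B :: "'a set" and u
    using that by (induction B) (auto simp flip: cis_mult)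
  have eq: "complex_of_real (exp (- ((norm x)\<^sup>2 / 2))) * cis (t \<bullet> x)
      = (\<Prod>b\<in>Basis. complex_of_real (exp (- ((x \<bullet> b)\<^sup>2 / 2))) * cis ((t \<bullet> b) * (x \<bullet> b)))" for x
    by (simp add: prod.distrib euclidean_inner[of t x] cs nrm sum_divide_distrib flip: sum_negf exp_sum of_real_prod)
  show "integrable lborel (\<lambda>x. complex_of_real (exp (- ((norm x)\<^sup>2 / 2))) * cis (t \<bullet> x))"
    unfolding eq by (rule integrable_lborel_prod) (rule integrable_gaussian_1d)
  show "(LINT x|lborel. complex_of_real (exp (- ((norm x)\<^sup>2 / 2))) * cis (t \<bullet> x))
        = sqrt (2 * pi) ^ DIM('a) * exp (- ((norm t)\<^sup>2 / 2))"
    unfolding eq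
    by (subst integral_lborel_prod, rule integrable_gaussian_1d)
       (simp add: integral_gaussian_1d nrm sum_divide_distrib prod.distrib flip: sum_negf exp_sum of_real_prod)
qed

lemma
  fixes c :: real and t :: "'a::euclidean_space" and u :: "'a \<Rightarrow> 'b::{banach, second_countable_topology}"
  assumes "c \<noteq> 0" and [measurable]: "u \<in> borel_measurable borel"
  shows integral_lborel_affine: "(LINT x|lborel. u x) = \<bar>c\<bar> ^ DIM('a) *\<^sub>R (LINT x|lborel. u (t + c *\<^sub>R x))"
    and integrable_lborel_affine: "integrable lborel (\<lambda>x. u (t + c *\<^sub>R x)) \<longleftrightarrow> integrable lborel u"
proof -
  show "(LINT x|lborel. u x) = \<bar>c\<bar> ^ DIM('a) *\<^sub>R (LINT x|lborel. u (t + c *\<^sub>R x))"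
    by (subst lborel_affine[OF assms(1), of t]) (simp add: integral_density integral_distr)
  show "integrable lborel (\<lambda>x. u (t + c *\<^sub>R x)) \<longleftrightarrow> integrable lborel u"
    using assms(1) integrable_scaleR_right[of "inverse (\<bar>c\<bar> ^ DIM('a))" lborel
      "\<lambda>x. \<bar>c\<bar> ^ DIM('a) *\<^sub>R u (t + c *\<^sub>R x)"]
    by (subst (2) lborel_affine[OF assms(1), of t])
       (auto simp: integrable_density integrable_distr_eq)
qed

lemma nn_integral_lborel_affine:
  fixes c :: real and t :: "'a::euclidean_space"
  assumes "c \<noteq> 0" and [measurable]: "u \<in> borel_measurable borel"
  shows "(\<integral>\<^sup>+x. u x \<partial>lborel) = ennreal (\<bar>c\<bar> ^ DIM('a)) * (\<integral>\<^sup>+x. u (t + c *\<^sub>R x) \<partial>lborel)"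
  by (subst lborel_affine[OF assms(1), of t])
     (simp add: nn_integral_density nn_integral_distr nn_integral_cmult)

lemma nn_integral_lborel_minus:
  fixes t :: "'a::euclidean_space"
  assumes [measurable]: "u \<in> borel_measurable borel"
  shows "(\<integral>\<^sup>+x. u (t - x) \<partial>lborel) = (\<integral>\<^sup>+x. u x \<partial>lborel)"
    and "(\<integral>\<^sup>+x. u (x - t) \<partial>lborel) = (\<integral>\<^sup>+x. u x \<partial>lborel)"
  using nn_integral_lborel_affine[of "-1" u t] nn_integral_lborel_affine[of 1 u "-t"] by simp_all

lemma
  fixes \<epsilon> :: real and w :: "'a::euclidean_space"
  assumes "\<epsilon> > 0"
  shows integrable_gaussian_scaled: "integrable lborel (\<lambda>x::'a. exp (- ((norm (\<epsilon> *\<^sub>R x))\<^sup>2 / 2)))"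
    and integral_gaussian_scaled:
      "(LINT x|lborel. complex_of_real (exp (- ((norm (\<epsilon> *\<^sub>R x))\<^sup>2 / 2))) * cis (w \<bullet> x))
        = (sqrt (2 * pi) / \<epsilon>) ^ DIM('a) * exp (- ((norm (w /\<^sub>R \<epsilon>))\<^sup>2 / 2))"
proof -
  have "integrable lborel (\<lambda>x::'a. complex_of_real (exp (- ((norm x)\<^sup>2 / 2))))"
    using integrable_gaussian[of "0::'a"] by simp
  then have "integrable lborel (\<lambda>x::'a. exp (- ((norm x)\<^sup>2 / 2)))"
    by (rule complex_of_real_integrable_eq[THEN iffD1])
  then show "integrable lborel (\<lambda>x::'a. exp (- ((norm (\<epsilon> *\<^sub>R x))\<^sup>2 / 2)))"
    using integrable_lborel_affine[of \<epsilon> "\<lambda>x::'a. exp (- ((norm x)\<^sup>2 / 2))" 0] assms by simp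
  show "(LINT x|lborel. complex_of_real (exp (- ((norm (\<epsilon> *\<^sub>R x))\<^sup>2 / 2))) * cis (w \<bullet> x))
        = (sqrt (2 * pi) / \<epsilon>) ^ DIM('a) * exp (- ((norm (w /\<^sub>R \<epsilon>))\<^sup>2 / 2))"
    using integral_lborel_affine[of \<epsilon> "\<lambda>x::'a. complex_of_real (exp (- ((norm x)\<^sup>2 / 2))) * cis ((w /\<^sub>R \<epsilon>) \<bullet> x)" 0]
      integral_gaussian[of "w /\<^sub>R \<epsilon>"] assms
    by (simp add: field_simps scaleR_conv_of_real power_divide)
qed

section \<open>Continuity of translations in L^1\<close>

text \<open>Inner regularity first gives a closed \<open>C\<close>. Cutting \<open>C\<close> with
  growing balls makes it compact, and since \<open>A\<close> has finite measure, continuity from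
  above along \<open>?D\<close> shows that a large ball costs little.\<close>

lemma borel_inner_compact:
  fixes A :: "'a::euclidean_space set"
  assumes "A \<in> sets borel" and "emeasure lborel A < \<infinity>" and "e > 0"
  obtains K where "compact K" and "K \<subseteq> A" and "emeasure lborel (A - K) < ennreal e"
proof -
  obtain C where C: "closed C" "C \<subseteq> A" "emeasure lebesgue (A - C) < ennreal e"
    by (rule sets_lebesgue_inner_closed[of A e]) (use assms in auto)
  let ?D = "\<lambda>n :: nat. A - (C \<inter> cball 0 (real n))"
  have D: "?D n \<in> sets borel" for n
    using assms C by (auto intro!: borel_closed)
  have "(\<lambda>n. emeasure lborel (?D n)) \<longlonglongrightarrow> emeasure lborel (\<Inter>n. ?D n)"
  proof (rule Lim_emeasure_decseq)
    show "decseq ?D"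
      by (auto simp: decseq_def)
    show "emeasure lborel (?D n) \<noteq> \<infinity>" for n
      using emeasure_mono[of "?D n" A lborel] assms by (auto simp: top_unique)
  qed (use D in auto)
  also have "(\<Inter>n. ?D n) = A - C"
    using real_arch_simple by (auto simp: dist_norm)
  finally have "eventually (\<lambda>n. emeasure lborel (?D n) < ennreal e) sequentially"
    using C assms by (intro order_tendstoD) (auto intro: borel_closed)
  then obtain n where "emeasure lborel (?D n) < ennreal e"
    by (auto simp: eventually_sequentially)
  moreover have "C \<inter> cball 0 (real n) \<subseteq> A" "compact (C \<inter> cball 0 (real n))"
    using C by (auto intro: closed_Int_compact)
  ultimately show ?thesis
    using that by metis
qed

text \<open>An integrable function is approximated in \<open>L\<^sup>1\<close> by simple ones, and the indicator of a set of
  finite measure is squeezed between a compact and an open set.\<close>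

theorem L1_translation_continuous:
  fixes h :: "'a::euclidean_space \<Rightarrow> complex"
  assumes "integrable lborel h" and "\<epsilon> > 0"
  shows "\<exists>\<delta>>0. \<forall>w. norm w < \<delta> \<longrightarrow> (\<integral>\<^sup>+x. norm (h (x - w) - h x) \<partial>lborel) < ennreal \<epsilon>"
  using assms
proof (induction h arbitrary: \<epsilon> rule: integrable_induct)
  case (base A c)
  then have A: "A \<in> sets borel" "emeasure lborel A < \<infinity>" by auto
  \<comment> \<open>The error set \<open>U - K\<close> has measure at most \<open>2 * e\<close> and
    is met twice, at \<open>x\<close> and at \<open>x - w\<close>, each time with weight
    \<open>norm c\<close>: in total \<open>4 * e * norm c\<close>. The summand 1 guards against
    \<open>c = 0\<close>.\<close>
  define e where "e = \<epsilon> / (4 * (1 + norm c))"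
  have "e > 0" using base by (simp add: e_def add_pos_nonneg)
  obtain U where U: "open U" "A \<subseteq> U" "emeasure lebesgue (U - A) < ennreal e"
    by (rule sets_lebesgue_outer_open[of A e]) (use A \<open>e > 0\<close> in auto)
  obtain K where K: "compact K" "K \<subseteq> A" "emeasure lborel (A - K) < ennreal e"
    using borel_inner_compact[OF A \<open>e > 0\<close>] by metis
  have UK[measurable]: "U - K \<in> sets borel"
    using U K by (auto intro: borel_open borel_compact)
  have "emeasure lborel (U - K) \<le> emeasure lborel ((U - A) \<union> (A - K))"
    using U K A by (intro emeasure_mono) (auto intro: borel_open borel_compact)
  also have "\<dots> \<le> emeasure lborel (U - A) + emeasure lborel (A - K)"
    using U K A by (intro emeasure_subadditive) (auto intro: borel_open borel_compact)
  also have "\<dots> < ennreal e + ennreal e"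
    using U K A by (intro add_strict_mono) (auto intro: borel_open)
  finally have m: "emeasure lborel (U - K) \<le> ennreal (2 * e)"
    using \<open>e > 0\<close> by (simp flip: ennreal_plus)
  obtain \<delta> where \<delta>: "\<delta> > 0" "(\<Union>x\<in>K. ball x \<delta>) \<subseteq> U"
    using compact_subset_open_imp_ball_epsilon_subset[OF K(1) U(1)] K U by blast
  show ?case
  proof (intro exI[of _ \<delta>] conjI allI impI)
    fix w :: 'a assume w: "norm w < \<delta>"
    \<comment> \<open>If exactly one of \<open>x\<close> and \<open>x - w\<close> lies in
      \<open>A\<close>, it lies in \<open>U\<close>. Either it is outside \<open>K\<close>, or it is
      in \<open>K\<close> and then the other point is in \<open>U\<close> but not in
      \<open>A\<close>; in both cases one of the two is in \<open>U - K\<close>.\<close>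
    have *: "norm (indicator A (x - w) *\<^sub>R c - indicator A x *\<^sub>R c)
        \<le> norm c * (indicator (U - K) x + indicator (U - K) (x - w))" for x
    proof -
      have "x \<in> ball (x - w) \<delta>" and "x - w \<in> ball x \<delta>"
        using w by (simp_all add: dist_norm)
      then have "x - w \<in> K \<Longrightarrow> x \<in> U" and "x \<in> K \<Longrightarrow> x - w \<in> U"
        using \<delta>(2) by blast+
      then show ?thesis
        using U K by (auto simp: indicator_def)
    qed
    have "(\<integral>\<^sup>+x. norm (indicator A (x - w) *\<^sub>R c - indicator A x *\<^sub>R c) \<partial>lborel)
        \<le> (\<integral>\<^sup>+x. norm c * (indicator (U - K) x + indicator (U - K) (x - w)) \<partial>lborel)"
      by (intro nn_integral_mono ennreal_leI *)
    also have "\<dots> = (\<integral>\<^sup>+x. ennreal (norm c) * indicator (U - K) x + ennreal (norm c) * indicator (U - K) (x - w) \<partial>lborel)"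
      by (intro nn_integral_cong) (auto simp: indicator_def simp flip: ennreal_plus)
    also have "\<dots> = ennreal (norm c) * emeasure lborel (U - K)
        + ennreal (norm c) * (\<integral>\<^sup>+x. indicator (U - K) (x - w) \<partial>lborel)"
      by (simp add: nn_integral_add nn_integral_cmult)
    also have "(\<integral>\<^sup>+x. indicator (U - K) (x - w) \<partial>lborel) = emeasure lborel (U - K)"
      using nn_integral_lborel_minus(2)[of "indicator (U - K)" w] by simp
    also have "ennreal (norm c) * emeasure lborel (U - K) + ennreal (norm c) * emeasure lborel (U - K)
        \<le> ennreal (norm c) * ennreal (2 * e) + ennreal (norm c) * ennreal (2 * e)"
      by (intro add_mono mult_left_mono m) auto
    also have "\<dots> = ennreal (norm c * (4 * e))"
      using \<open>e > 0\<close> by (simp add: algebra_simps flip: ennreal_plus ennreal_mult)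
    also have "\<dots> < ennreal \<epsilon>"
      using base \<open>e > 0\<close> by (intro ennreal_lessI) (auto simp: e_def field_simps add_pos_nonneg)
    finally show "(\<integral>\<^sup>+x. norm (indicator A (x - w) *\<^sub>R c - indicator A x *\<^sub>R c) \<partial>lborel) < ennreal \<epsilon>" .
  qed (fact \<delta>)
next
  case (add f g)
  note [measurable] = add.hyps(1,2)[THEN borel_measurable_integrable]
  obtain \<delta>1 \<delta>2 where \<delta>: "\<delta>1 > 0" "\<delta>2 > 0"
    and f: "\<And>w. norm w < \<delta>1 \<Longrightarrow> (\<integral>\<^sup>+x. norm (f (x - w) - f x) \<partial>lborel) < ennreal (\<epsilon> / 2)"
    and g: "\<And>w. norm w < \<delta>2 \<Longrightarrow> (\<integral>\<^sup>+x. norm (g (x - w) - g x) \<partial>lborel) < ennreal (\<epsilon> / 2)"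
    using add.IH(1)[of "\<epsilon> / 2"] add.IH(2)[of "\<epsilon> / 2"] add.prems by auto
  show ?case
  proof (intro exI[of _ "min \<delta>1 \<delta>2"] conjI allI impI)
    fix w :: 'a assume w: "norm w < min \<delta>1 \<delta>2"
    have "(\<integral>\<^sup>+x. norm (f (x - w) + g (x - w) - (f x + g x)) \<partial>lborel)
        \<le> (\<integral>\<^sup>+x. ennreal (norm (f (x - w) - f x)) + ennreal (norm (g (x - w) - g x)) \<partial>lborel)"
      by (intro nn_integral_mono) (simp add: norm_diff_triangle_ineq flip: ennreal_plus)
    also have "\<dots> = (\<integral>\<^sup>+x. norm (f (x - w) - f x) \<partial>lborel) + (\<integral>\<^sup>+x. norm (g (x - w) - g x) \<partial>lborel)"
      by (rule nn_integral_add) auto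
    also have "\<dots> < ennreal (\<epsilon> / 2) + ennreal (\<epsilon> / 2)"
      using w f g by (intro add_strict_mono) auto
    finally show "(\<integral>\<^sup>+x. norm (f (x - w) + g (x - w) - (f x + g x)) \<partial>lborel) < ennreal \<epsilon>"
      using add.prems by (simp flip: ennreal_plus)
  qed (use \<delta> in auto)
next
  case (lim f s)
  note [measurable] = lim.hyps(1,4)[THEN borel_measurable_integrable]
  have "(\<lambda>i. \<integral>\<^sup>+x. norm (f x - s i x) \<partial>lborel) \<longlonglongrightarrow> 0"
  proof (rule nn_integral_dominated_convergence_norm[where w = "\<lambda>x. 2 * norm (f x)"])
    show "(\<integral>\<^sup>+x. ennreal (2 * norm (f x)) \<partial>lborel) < \<infinity>"
      using lim.hyps(4) by (auto simp: integrable_iff_bounded ennreal_mult nn_integral_cmult ennreal_mult_less_top)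
  qed (use lim.hyps in auto)
  then have "eventually (\<lambda>i. (\<integral>\<^sup>+x. norm (f x - s i x) \<partial>lborel) < ennreal (\<epsilon> / 3)) sequentially"
    using lim.prems by (intro order_tendstoD) auto
  then obtain i where i: "(\<integral>\<^sup>+x. norm (f x - s i x) \<partial>lborel) < ennreal (\<epsilon> / 3)"
    by (auto simp: eventually_sequentially)
  obtain \<delta> where \<delta>: "\<delta> > 0"
    and s: "\<And>w. norm w < \<delta> \<Longrightarrow> (\<integral>\<^sup>+x. norm (s i (x - w) - s i x) \<partial>lborel) < ennreal (\<epsilon> / 3)"
    using lim.IH(1)[of "\<epsilon> / 3" i] lim.prems by auto
  show ?case
  proof (intro exI[of _ \<delta>] conjI allI impI)
    fix w :: 'a assume w: "norm w < \<delta>"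
    let ?d = "\<lambda>x. ennreal (norm (f x - s i x))"
    have tri: "norm (a - b) \<le> norm (a - c) + norm (c - d) + norm (b - d)" for a b c d :: complex
      using norm_triangle_ineq[of "a - c" "c - d"] norm_triangle_ineq[of "(a - c) + (c - d)" "d - b"]
      by (simp add: norm_minus_commute[of d b])
    have "(\<integral>\<^sup>+x. norm (f (x - w) - f x) \<partial>lborel)
        \<le> (\<integral>\<^sup>+x. ?d (x - w) + ennreal (norm (s i (x - w) - s i x)) + ?d x \<partial>lborel)"
      by (intro nn_integral_mono) (simp add: tri flip: ennreal_plus)
    also have "\<dots> = (\<integral>\<^sup>+x. ?d (x - w) \<partial>lborel) + (\<integral>\<^sup>+x. norm (s i (x - w) - s i x) \<partial>lborel) + (\<integral>\<^sup>+x. ?d x \<partial>lborel)"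
      by (simp add: nn_integral_add)
    \<comment> \<open>By translation invariance the approximation error at the shifted point equals
      the unshifted one, whatever \<open>w\<close> is.\<close>
    also have "(\<integral>\<^sup>+x. ?d (x - w) \<partial>lborel) = (\<integral>\<^sup>+x. ?d x \<partial>lborel)"
      by (rule nn_integral_lborel_minus) simp
    also have "(\<integral>\<^sup>+x. ?d x \<partial>lborel) + (\<integral>\<^sup>+x. norm (s i (x - w) - s i x) \<partial>lborel) + (\<integral>\<^sup>+x. ?d x \<partial>lborel)
        < ennreal (\<epsilon> / 3) + ennreal (\<epsilon> / 3) + ennreal (\<epsilon> / 3)"
      using w i s by (intro add_strict_mono) auto
    finally show "(\<integral>\<^sup>+x. norm (f (x - w) - f x) \<partial>lborel) < ennreal \<epsilon>"
      using lim.prems by (simp flip: ennreal_plus)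
  qed (fact \<delta>)
qed

subsection \<open>Plancherel identity for bounded integrable functions\<close>

lemma borel_measurable_cnj[measurable (raw)]:
  "f \<in> borel_measurable M \<Longrightarrow> (\<lambda>x. cnj (f x)) \<in> borel_measurable M"
  by (rule measurable_compose[where g = cnj]) (auto intro!: borel_measurable_continuous_onI continuous_intros)

lemma integrable_mult_cis:
  assumes "integrable M h" and [measurable]: "u \<in> borel_measurable M"
  shows "integrable M (\<lambda>x. h x * cis (u x))"
proof -
  note [measurable] = borel_measurable_integrable[OF assms(1)]
  show ?thesis
    by (rule Bochner_Integration.integrable_bound[OF assms(1)]) (auto simp: norm_mult)
qed

text \<open>\<open>lebesgue\<close> is the completion of \<open>lborel\<close>, so for Borel
  functions the transform may be computed with the measure for which Fubini's theorem is at
  hand.\<close>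

lemma fourier_lborel:
  assumes [measurable]: "h \<in> borel_measurable borel"
  shows "fourier h \<xi> = (LINT x|lborel. h x * cis (- 2 * pi * (x \<bullet> \<xi>)))"
  unfolding fourier_def by (rule integral_completion) simp

lemma borel_measurable_fourier:
  assumes [measurable]: "h \<in> borel_measurable borel"
  shows "fourier h \<in> borel_measurable borel"
proof -
  have "(\<lambda>\<xi>. LINT x|lborel. h x * cis (- 2 * pi * (x \<bullet> \<xi>))) \<in> borel_measurable borel"
    by (intro lborel.borel_measurable_lebesgue_integral) simp
  then show ?thesis
    using fourier_lborel[OF assms] by (simp add: fun_eq_iff[symmetric] cong: measurable_cong)
qed

lemma norm_fourier_le:
  assumes [measurable]: "h \<in> borel_measurable borel"
  shows "norm (fourier h \<xi>) \<le> (LINT x|lborel. norm (h x))"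
proof -
  have "norm (fourier h \<xi>) \<le> (LINT x|lborel. norm (h x * cis (- 2 * pi * (x \<bullet> \<xi>))))"
    unfolding fourier_lborel[OF assms] by (rule integral_norm_bound)
  then show ?thesis
    by (simp add: norm_mult)
qed

text \<open>The multiplication formula: the kernel is symmetric in the two variables and has modulus
  1, so the double integral converges absolutely and can be read in either order.\<close>

lemma integral_mult_fourier:
  fixes u h :: "real^'n \<Rightarrow> complex"
  assumes u: "integrable lborel u" and h: "integrable lborel h"
  shows "(LINT \<xi>|lborel. u \<xi> * fourier h \<xi>) = (LINT x|lborel. fourier u x * h x)"
proof -
  note [measurable] = borel_measurable_integrable[OF u] borel_measurable_integrable[OF h]
  let ?F = "\<lambda>\<xi> x :: real^'n. u \<xi> * h x * cis (- 2 * pi * (x \<bullet> \<xi>))"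
  have int: "integrable (lborel \<Otimes>\<^sub>M lborel) (case_prod ?F)"
  proof (rule lborel_pair.Fubini_integrable)
    show "integrable lborel (\<lambda>\<xi>. LINT x|lborel. norm (case_prod ?F (\<xi>, x)))"
      using u by (simp add: norm_mult)
    show "AE \<xi> in lborel. integrable lborel (\<lambda>x. case_prod ?F (\<xi>, x))"
      using h by (auto intro!: integrable_mult_cis)
  qed simp
  have "(LINT \<xi>|lborel. u \<xi> * fourier h \<xi>) = (LINT \<xi>|lborel. LINT x|lborel. ?F \<xi> x)"
    by (simp add: fourier_lborel mult.assoc)
  also have "\<dots> = (LINT x|lborel. LINT \<xi>|lborel. ?F \<xi> x)"
    using lborel_pair.Fubini_integral[OF int] by simp
  also have "\<dots> = (LINT x|lborel. fourier u x * h x)"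
  proof (intro Bochner_Integration.integral_cong refl)
    fix x
    have "(LINT \<xi>|lborel. ?F \<xi> x) = (LINT \<xi>|lborel. (u \<xi> * cis (- 2 * pi * (\<xi> \<bullet> x))) * h x)"
      by (intro Bochner_Integration.integral_cong refl) (simp only: inner_commute[of x] mult_ac)
    also have "\<dots> = fourier u x * h x"
      unfolding integral_mult_left_zero by (subst fourier_lborel) simp_all
    finally show "(LINT \<xi>|lborel. ?F \<xi> x) = fourier u x * h x" .
  qed
  finally show ?thesis .
qed

section \<open>Gaussian regularisation of the Fourier energy\<close>

text \<open>The standard normal probability density in dimension \<open>DIM('a)\<close>.\<close>

definition gauss_density :: "'a::euclidean_space \<Rightarrow> real" where
  "gauss_density z = exp (- ((norm z)\<^sup>2 / 2)) / sqrt (2 * pi) ^ DIM('a)"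

lemma borel_measurable_gauss_density[measurable]: "gauss_density \<in> borel_measurable borel"
  unfolding gauss_density_def[abs_def] by measurable

lemma gauss_density_nonneg[simp]: "gauss_density z \<ge> 0"
  by (simp add: gauss_density_def)

lemma integrable_gauss_density: "integrable lborel (gauss_density :: 'a::euclidean_space \<Rightarrow> real)"
  using integrable_gaussian_scaled[of 1, where 'a = 'a] unfolding gauss_density_def[abs_def] by simp

lemma integral_gauss_density: "(LINT z|lborel. gauss_density (z :: 'a::euclidean_space)) = 1"
proof -
  have "complex_of_real (LINT z|lborel. exp (- ((norm (z :: 'a))\<^sup>2 / 2))) = complex_of_real (sqrt (2 * pi) ^ DIM('a))"
    using integral_gaussian[of "0 :: 'a"] by (simp flip: integral_complex_of_real)
  then show ?thesis
    unfolding gauss_density_def by (simp only: of_real_eq_iff) simp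
qed

text \<open>The multiplication formula is used twice. Modulating the weight \<open>k\<close> gives
  \<open>v x\<close>, whose transform is the normal density of standard deviation
  \<open>\<delta>\<close> around \<open>x\<close>; hence pairing \<open>v x\<close> with
  \<open>fourier h\<close> yields the mollification \<open>G x\<close>. This in turn identifies the
  transform of \<open>u\<close>, the weight times the conjugate of \<open>fourier h\<close>, as
  \<open>cnj (G x)\<close>, and pairing \<open>u\<close> with \<open>fourier h\<close> gives the
  claim. The factor \<open>2 * pi * \<delta>\<close> in \<open>k\<close> is what makes the mollifier
  have scale \<open>\<delta>\<close>.\<close>

lemma
  fixes h :: "real^'n \<Rightarrow> complex"
  assumes h: "integrable lborel h" and "\<delta> > 0"
  defines "k \<equiv> \<lambda>\<xi> :: real^'n. exp (- ((norm ((2 * pi * \<delta>) *\<^sub>R \<xi>))\<^sup>2 / 2))"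
  shows integrable_gauss_fourier: "integrable lborel (\<lambda>\<xi>. k \<xi> * (norm (fourier h \<xi>))\<^sup>2)"
    and integral_gauss_fourier: "complex_of_real (LINT \<xi>|lborel. k \<xi> * (norm (fourier h \<xi>))\<^sup>2)
      = (LINT x|lborel. cnj (LINT z|lborel. gauss_density z * h (x - \<delta> *\<^sub>R z)) * h x)"
proof -
  define G where "G x = (LINT z|lborel. gauss_density z * h (x - \<delta> *\<^sub>R z))" for x
  have [measurable]: "h \<in> borel_measurable borel"
    using borel_measurable_integrable[OF h] by simp
  note [measurable] = borel_measurable_fourier[of h]
  have [measurable]: "k \<in> borel_measurable borel"
    unfolding k_def by measurable
  define C where "C = (LINT x|lborel. norm (h x))"
  have C: "norm (fourier h \<xi>) \<le> C" for \<xi>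
    unfolding C_def by (rule norm_fourier_le) simp
  have C0: "C \<ge> 0"
    by (simp add: C_def)
  have k: "integrable lborel k" "k \<xi> \<ge> 0" for \<xi>
    using integrable_gaussian_scaled[of "2 * pi * \<delta>", where 'a = "real^'n"] \<open>\<delta> > 0\<close>
    unfolding k_def by simp_all
  then have kc: "integrable lborel (\<lambda>\<xi>. complex_of_real (k \<xi>))"
    by simp
  show int: "integrable lborel (\<lambda>\<xi>. k \<xi> * (norm (fourier h \<xi>))\<^sup>2)"
  proof (rule Bochner_Integration.integrable_bound)
    show "integrable lborel (\<lambda>\<xi>. k \<xi> * C\<^sup>2)"
      using k by simp
    show "AE \<xi> in lborel. norm (k \<xi> * (norm (fourier h \<xi>))\<^sup>2) \<le> norm (k \<xi> * C\<^sup>2)"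
      using k C by (auto simp: abs_mult intro!: mult_left_mono power_mono)
  qed simp
  define v where "v x \<xi> = k \<xi> * cis (2 * pi * (x \<bullet> \<xi>))" for x \<xi>
  have v: "integrable lborel (v x)" for x
    unfolding v_def using kc by (intro integrable_mult_cis) auto
  have fv: "fourier (v x) y = (sqrt (2 * pi) / (2 * pi * \<delta>)) ^ CARD('n) * exp (- ((norm ((x - y) /\<^sub>R \<delta>))\<^sup>2 / 2))" for x y
  proof -
    have "fourier (v x) y = (LINT \<xi>|lborel. v x \<xi> * cis (- 2 * pi * (\<xi> \<bullet> y)))"
      using borel_measurable_integrable[OF v[of x]] by (intro fourier_lborel) simp
    also have "\<dots> = (LINT \<xi>|lborel. k \<xi> * cis ((2 * pi) *\<^sub>R (x - y) \<bullet> \<xi>))"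
      by (intro Bochner_Integration.integral_cong refl)
         (simp add: v_def cis_mult mult.assoc inner_diff_left inner_commute algebra_simps)
    also have "\<dots> = (sqrt (2 * pi) / (2 * pi * \<delta>)) ^ DIM(real^'n)
        * exp (- ((norm (((2 * pi) *\<^sub>R (x - y)) /\<^sub>R (2 * pi * \<delta>)))\<^sup>2 / 2))"
      unfolding k_def using \<open>\<delta> > 0\<close> by (subst integral_gaussian_scaled) simp_all
    also have "((2 * pi) *\<^sub>R (x - y)) /\<^sub>R (2 * pi * \<delta>) = (x - y) /\<^sub>R \<delta>"
      using \<open>\<delta> > 0\<close> by (simp add: field_simps)
    finally show ?thesis by simp
  qed
  have vG: "(LINT \<xi>|lborel. v x \<xi> * fourier h \<xi>) = G x" for x
  proof -
    have "(LINT \<xi>|lborel. v x \<xi> * fourier h \<xi>) = (LINT y|lborel. fourier (v x) y * h y)"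
      by (rule integral_mult_fourier[OF v h])
    \<comment> \<open>Substitution \<open>y = x - \<delta> *\<^sub>R z\<close>; its Jacobian turns
      the scaled Gaussian into \<open>gauss_density z\<close>.\<close>
    also have "\<dots> = \<bar>- \<delta>\<bar> ^ DIM(real^'n) *\<^sub>R (LINT z|lborel. fourier (v x) (x + (- \<delta>) *\<^sub>R z) * h (x + (- \<delta>) *\<^sub>R z))"
      using \<open>\<delta> > 0\<close> by (intro integral_lborel_affine) (auto simp: fv)
    also have "\<dots> = (LINT z|lborel. \<delta> ^ CARD('n) *\<^sub>R (fourier (v x) (x - \<delta> *\<^sub>R z) * h (x - \<delta> *\<^sub>R z)))"
      using \<open>\<delta> > 0\<close> by simp
    also have "\<dots> = G x"
      unfolding G_def
    proof (intro Bochner_Integration.integral_cong refl)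
      fix z :: "real^'n"
      have "\<delta> * (sqrt (2 * pi) / (2 * pi * \<delta>)) = 1 / sqrt (2 * pi)"
        using \<open>\<delta> > 0\<close> by (simp add: field_simps)
      then have "\<delta> ^ CARD('n) * (sqrt (2 * pi) / (2 * pi * \<delta>)) ^ CARD('n) = 1 / sqrt (2 * pi) ^ CARD('n)"
        by (simp only: power_mult_distrib[symmetric] power_one_over)
      then have "\<delta> ^ CARD('n) * ((sqrt (2 * pi) / (2 * pi * \<delta>)) ^ CARD('n) * exp (- ((norm z)\<^sup>2 / 2))) = gauss_density z"
        by (simp add: gauss_density_def mult.assoc[symmetric])
      moreover have "fourier (v x) (x - \<delta> *\<^sub>R z)
          = complex_of_real ((sqrt (2 * pi) / (2 * pi * \<delta>)) ^ CARD('n) * exp (- ((norm z)\<^sup>2 / 2)))"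
        unfolding fv using \<open>\<delta> > 0\<close> by simp
      ultimately show "\<delta> ^ CARD('n) *\<^sub>R (fourier (v x) (x - \<delta> *\<^sub>R z) * h (x - \<delta> *\<^sub>R z)) = gauss_density z * h (x - \<delta> *\<^sub>R z)"
        by (simp only: scaleR_conv_of_real mult.assoc[symmetric] of_real_mult[symmetric])
    qed
    finally show ?thesis .
  qed
  \<comment> \<open>The conjugate is chosen so that \<open>u\<close> times \<open>fourier h\<close>
    is the weighted energy density; \<open>k\<close> makes \<open>u\<close> integrable although
    \<open>fourier h\<close> is only known to be bounded.\<close>
  define u where "u \<xi> = k \<xi> * cnj (fourier h \<xi>)" for \<xi>
  have u: "integrable lborel u"
    unfolding u_def
  proof (rule Bochner_Integration.integrable_bound)
    show "integrable lborel (\<lambda>\<xi>. k \<xi> * C)"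
      using k by simp
    show "AE \<xi> in lborel. norm (k \<xi> * cnj (fourier h \<xi>)) \<le> norm (k \<xi> * C)"
      using k C C0 by (auto simp: norm_mult abs_mult intro!: mult_left_mono)
  qed simp
  have fu: "fourier u x = cnj (G x)" for x
  proof -
    have "fourier u x = (LINT \<xi>|lborel. u \<xi> * cis (- 2 * pi * (\<xi> \<bullet> x)))"
      using borel_measurable_integrable[OF u] by (intro fourier_lborel) simp
    also have "\<dots> = (LINT \<xi>|lborel. cnj (v x \<xi> * fourier h \<xi>))"
      by (intro Bochner_Integration.integral_cong refl)
         (simp add: u_def v_def cis_cnj inner_commute mult_ac)
    also have "\<dots> = cnj (G x)"
      by (subst Bochner_Integration.integral_cnj) (simp only: vG)
    finally show ?thesis .
  qed
  have "complex_of_real (LINT \<xi>|lborel. k \<xi> * (norm (fourier h \<xi>))\<^sup>2) = (LINT \<xi>|lborel. u \<xi> * fourier h \<xi>)"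
    unfolding integral_complex_of_real[symmetric]
    by (intro Bochner_Integration.integral_cong refl)
       (simp add: u_def complex_norm_square[symmetric] mult.assoc mult.commute[of "cnj _"] del: of_real_power)
  also have "\<dots> = (LINT x|lborel. cnj (G x) * h x)"
    using integral_mult_fourier[OF u h] by (simp add: fu)
  finally show "complex_of_real (LINT \<xi>|lborel. k \<xi> * (norm (fourier h \<xi>))\<^sup>2)
      = (LINT x|lborel. cnj (LINT z|lborel. gauss_density z * h (x - \<delta> *\<^sub>R z)) * h x)"
    unfolding G_def .
qed

text \<open>The inner integral is the L^1 modulus of continuity of \<open>h\<close>. It tends to 0
  as the shift shrinks and never exceeds twice the L^1 norm, so dominated convergence applies
  against the Gaussian probability measure.\<close>

lemma tendsto_gauss_average:
  fixes h :: "'a::euclidean_space \<Rightarrow> complex"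
  assumes h: "integrable lborel h"
  shows "(\<lambda>n. \<integral>\<^sup>+z. ennreal (gauss_density z) *
      (\<integral>\<^sup>+x. norm (h (x - z /\<^sub>R real (Suc n)) - h x) \<partial>lborel) \<partial>lborel) \<longlonglongrightarrow> 0"
proof -
  have [measurable]: "h \<in> borel_measurable borel"
    using borel_measurable_integrable[OF h] by simp
  define \<omega> where "\<omega> w = (\<integral>\<^sup>+x. norm (h (x - w) - h x) \<partial>lborel)" for w :: 'a
  have [measurable]: "\<omega> \<in> borel_measurable borel"
    unfolding \<omega>_def by (intro lborel.borel_measurable_nn_integral) simp
  define C where "C = 2 * (\<integral>\<^sup>+x. norm (h x) \<partial>lborel)"
  have C: "C < \<infinity>"
    using h unfolding C_def integrable_iff_bounded by (auto simp: ennreal_mult_less_top)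
  have \<omega>C: "\<omega> w \<le> C" for w
  proof -
    have "\<omega> w \<le> (\<integral>\<^sup>+x. ennreal (norm (h (x - w))) + ennreal (norm (h x)) \<partial>lborel)"
      unfolding \<omega>_def by (intro nn_integral_mono) (simp add: norm_triangle_ineq4 flip: ennreal_plus)
    also have "\<dots> = (\<integral>\<^sup>+x. norm (h (x - w)) \<partial>lborel) + (\<integral>\<^sup>+x. norm (h x) \<partial>lborel)"
      by (rule nn_integral_add) auto
    also have "(\<integral>\<^sup>+x. norm (h (x - w)) \<partial>lborel) = (\<integral>\<^sup>+x. norm (h x) \<partial>lborel)"
      by (rule nn_integral_lborel_minus(2)) simp
    finally show ?thesis
      by (simp add: C_def mult_2)
  qed
  have "(\<lambda>n. \<integral>\<^sup>+z. ennreal (gauss_density z) * \<omega> (z /\<^sub>R real (Suc n)) \<partial>lborel) \<longlonglongrightarrow> nn_integral lborel (\<lambda>z::'a. 0)"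
  proof (rule nn_integral_dominated_convergence[where w = "\<lambda>z. ennreal (gauss_density z) * C"])
    have "(\<integral>\<^sup>+z. ennreal (gauss_density (z :: 'a)) \<partial>lborel) = 1"
      using nn_integral_eq_integral[OF integrable_gauss_density[where 'a = 'a]] integral_gauss_density[where 'a = 'a]
      by simp
    then show "(\<integral>\<^sup>+z. ennreal (gauss_density (z :: 'a)) * C \<partial>lborel) < \<infinity>"
      using C by (simp add: nn_integral_multc)
    show "AE z in lborel. ennreal (gauss_density z) * \<omega> (z /\<^sub>R real (Suc n)) \<le> ennreal (gauss_density z) * C" for n
      by (intro AE_I2 mult_left_mono \<omega>C) simp
    have "(\<lambda>n. ennreal (gauss_density z) * \<omega> (z /\<^sub>R real (Suc n))) \<longlonglongrightarrow> 0" for z :: 'a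
    proof -
      have z: "(\<lambda>n. z /\<^sub>R real (Suc n)) \<longlonglongrightarrow> 0"
        using tendsto_scaleR[OF LIMSEQ_inverse_real_of_nat tendsto_const[of z]] by simp
      have "(\<lambda>n. \<omega> (z /\<^sub>R real (Suc n))) \<longlonglongrightarrow> 0"
      proof (rule order_tendstoI)
        fix a :: ennreal assume "a > 0"
        then obtain e where e: "0 < e" "ennreal e \<le> a"
          by (metis ennreal_less_zero_iff ennreal_rat_dense less_imp_le ennreal_0 zero_less_iff_neq_zero)
        then obtain \<delta> where "\<delta> > 0" and \<delta>: "\<And>w. norm w < \<delta> \<Longrightarrow> \<omega> w < ennreal e"
          unfolding \<omega>_def using L1_translation_continuous[OF h] by blast
        have "eventually (\<lambda>n. norm (z /\<^sub>R real (Suc n)) < \<delta>) sequentially"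
          using tendsto_norm[OF z] \<open>\<delta> > 0\<close> by (intro order_tendstoD) auto
        then show "eventually (\<lambda>n. \<omega> (z /\<^sub>R real (Suc n)) < a) sequentially"
          by eventually_elim (rule less_le_trans[OF \<delta> e(2)])
      qed simp
      then show ?thesis
        using ennreal_tendsto_cmult[of "ennreal (gauss_density z)" "\<lambda>n. \<omega> (z /\<^sub>R real (Suc n))" 0] by simp
    qed
    then show "AE z in lborel. (\<lambda>n. ennreal (gauss_density z) * \<omega> (z /\<^sub>R real (Suc n))) \<longlonglongrightarrow> 0"
      by simp
  qed simp_all
  then show ?thesis
    by (simp add: \<omega>_def)
qed

text \<open>The Gaussian factor turns the energy of the transform into the correlation of \<open>h\<close> with its
  mollification; boundedness of \<open>h\<close> makes \<open>L\<^sup>1\<close> continuity of translations sufficient for the limit.\<close>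

theorem plancherel_bounded:
  fixes h :: "real^'n \<Rightarrow> complex"
  assumes h: "integrable lborel h" and B: "\<And>x. norm (h x) \<le> B"
  shows "(\<integral>\<^sup>+\<xi>. ennreal ((norm (fourier h \<xi>))\<^sup>2) \<partial>lborel) = (\<integral>\<^sup>+x. ennreal ((norm (h x))\<^sup>2) \<partial>lborel)"
proof -
  have [measurable]: "h \<in> borel_measurable borel"
    using borel_measurable_integrable[OF h] by simp
  note [measurable] = borel_measurable_fourier[of h]
  have B0: "B \<ge> 0"
    using B[of undefined] norm_ge_zero order_trans by blast
  have h2: "integrable lborel (\<lambda>x. (norm (h x))\<^sup>2)"
  proof (rule Bochner_Integration.integrable_bound)
    show "integrable lborel (\<lambda>x. B * norm (h x))"
      using h by simp
    show "AE x in lborel. norm ((norm (h x))\<^sup>2) \<le> norm (B * norm (h x))"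
      using B B0 by (auto simp: power2_eq_square abs_mult intro!: mult_right_mono)
  qed simp
  \<comment> \<open>The weight of the preceding identity at mollification scale 1/(n+1).\<close>
  define k where "k n \<xi> = exp (- ((norm ((2 * pi * inverse (real (Suc n))) *\<^sub>R \<xi>))\<^sup>2 / 2))" for n and \<xi> :: "real^'n"
  have [measurable]: "k n \<in> borel_measurable borel" for n
    unfolding k_def by measurable
  define E where "E n = (LINT \<xi>|lborel. k n \<xi> * (norm (fourier h \<xi>))\<^sup>2)" for n
  define G where "G n x = (LINT z|lborel. gauss_density z * h (x - z /\<^sub>R real (Suc n)))" for n and x :: "real^'n"
  have intk: "integrable lborel (\<lambda>\<xi>. k n \<xi> * (norm (fourier h \<xi>))\<^sup>2)" for n
    using integrable_gauss_fourier[OF h, of "inverse (real (Suc n))"] unfolding k_def by simp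
  have E: "complex_of_real (E n) = (LINT x|lborel. cnj (G n x) * h x)" for n
    using integral_gauss_fourier[OF h, of "inverse (real (Suc n))"] unfolding k_def E_def G_def by simp
  define I where "I = (LINT x|lborel. (norm (h x))\<^sup>2)"
  have I: "complex_of_real I = (LINT x|lborel. cnj (h x) * h x)"
    unfolding I_def integral_complex_of_real[symmetric]
    by (intro Bochner_Integration.integral_cong refl)
       (simp add: complex_norm_square[symmetric] mult.commute[of "cnj _"] del: of_real_power)
  have int\<gamma>: "integrable lborel (\<lambda>z. gauss_density z * u z)"
    if [measurable]: "u \<in> borel_measurable borel" and "\<And>z. norm (u z) \<le> B" for u :: "real^'n \<Rightarrow> complex"
  proof (rule Bochner_Integration.integrable_bound)
    show "integrable lborel (\<lambda>z :: real^'n. gauss_density z * B)"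
      using integrable_gauss_density[where 'a = "real^'n"] by simp
    show "AE z in lborel. norm (gauss_density z * u z) \<le> norm (gauss_density z * B)"
      using that(2) B0
      by (auto simp: norm_mult abs_mult intro!: mult_left_mono)
  qed simp
  have Gmeas[measurable]: "G n \<in> borel_measurable borel" for n
    unfolding G_def by (intro lborel.borel_measurable_lebesgue_integral) simp
  have GB: "norm (G n x) \<le> B" for n x
  proof -
    have "norm (G n x) \<le> (LINT z|lborel. norm (gauss_density z * h (x - z /\<^sub>R real (Suc n))))"
      unfolding G_def by (rule integral_norm_bound)
    also have "\<dots> \<le> (LINT z|lborel. gauss_density (z :: real^'n) * B)"
    proof (rule Bochner_Integration.integral_mono)
      show "integrable lborel (\<lambda>z. norm (gauss_density z * h (x - z /\<^sub>R real (Suc n))))"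
        using B by (intro integrable_norm int\<gamma>) auto
      show "integrable lborel (\<lambda>z :: real^'n. gauss_density z * B)"
        using integrable_gauss_density[where 'a = "real^'n"] by simp
      show "norm (gauss_density z * h (x - z /\<^sub>R real (Suc n))) \<le> gauss_density z * B" for z :: "real^'n"
        using B by (auto simp: norm_mult intro!: mult_left_mono)
    qed
    also have "\<dots> = B"
      using integral_gauss_density[where 'a = "real^'n"] by simp
    finally show ?thesis .
  qed
  \<comment> \<open>The difference is the integral of \<open>cnj (G n x - h x) * h x\<close>. One
    factor \<open>h\<close> is bounded by \<open>B\<close>; the other is an average of
    \<open>h (x - w) - h x\<close>, and exchanging the integrals leaves the L^1 modulus of
    continuity.\<close>
  have err: "ennreal (norm (complex_of_real (E n - I)))
      \<le> ennreal B * (\<integral>\<^sup>+z. ennreal (gauss_density z) *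
          (\<integral>\<^sup>+x. norm (h (x - z /\<^sub>R real (Suc n)) - h x) \<partial>lborel) \<partial>lborel)" for n
  proof -
    have bdd: "integrable lborel (\<lambda>x. u x * h x)"
      if [measurable]: "u \<in> borel_measurable borel" and "\<And>x. norm (u x) \<le> B" for u :: "real^'n \<Rightarrow> complex"
    proof (rule Bochner_Integration.integrable_bound)
      show "integrable lborel (\<lambda>x. B * norm (h x))"
        using h by simp
      show "AE x in lborel. norm (u x * h x) \<le> norm (B * norm (h x))"
        using that(2) B0 by (auto simp: norm_mult abs_mult intro!: mult_right_mono)
    qed simp
    have d: "G n x - h x = (LINT z|lborel. gauss_density z * (h (x - z /\<^sub>R real (Suc n)) - h x))" for x
    proof -
      have "(LINT z|lborel. gauss_density (z :: real^'n) * h x) = h x"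
        using integral_gauss_density[where 'a = "real^'n"] by simp
      then have "G n x - h x = (LINT z|lborel. gauss_density z * h (x - z /\<^sub>R real (Suc n))) - (LINT z|lborel. gauss_density (z :: real^'n) * h x)"
        by (simp add: G_def)
      also have "\<dots> = (LINT z|lborel. gauss_density z * h (x - z /\<^sub>R real (Suc n)) - gauss_density z * h x)"
        using B by (intro Bochner_Integration.integral_diff[symmetric] int\<gamma>) auto
      finally show ?thesis
        by (simp add: right_diff_distrib)
    qed
    have "complex_of_real (E n - I) = (LINT x|lborel. cnj (G n x) * h x - cnj (h x) * h x)"
      unfolding of_real_diff E I using GB B
      by (intro Bochner_Integration.integral_diff[symmetric] bdd) auto
    also have "\<dots> = (LINT x|lborel. cnj (G n x - h x) * h x)"
      by (simp add: left_diff_distrib)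
    finally have "ennreal (norm (complex_of_real (E n - I))) \<le> (\<integral>\<^sup>+x. norm (cnj (G n x - h x) * h x) \<partial>lborel)"
      using integral_norm_bound_ennreal[of lborel "\<lambda>x. cnj (G n x - h x) * h x"] GB B
      by (simp add: left_diff_distrib bdd)
    also have "\<dots> \<le> (\<integral>\<^sup>+x. ennreal B * (\<integral>\<^sup>+z. ennreal (gauss_density z) * norm (h (x - z /\<^sub>R real (Suc n)) - h x) \<partial>lborel) \<partial>lborel)"
    proof (rule nn_integral_mono)
      fix x :: "real^'n"
      have "integrable lborel (\<lambda>z. gauss_density z * (h (x - z /\<^sub>R real (Suc n)) - h x))"
        unfolding right_diff_distrib using B by (intro Bochner_Integration.integrable_diff int\<gamma>) auto
      then have "ennreal (norm (G n x - h x)) \<le> (\<integral>\<^sup>+z. norm (gauss_density z * (h (x - z /\<^sub>R real (Suc n)) - h x)) \<partial>lborel)"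
        unfolding d by (rule integral_norm_bound_ennreal)
      also have "\<dots> = (\<integral>\<^sup>+z. ennreal (gauss_density z) * norm (h (x - z /\<^sub>R real (Suc n)) - h x) \<partial>lborel)"
        by (intro nn_integral_cong) (simp add: norm_mult ennreal_mult)
      finally have *: "ennreal (norm (G n x - h x)) \<le> \<dots>" .
      have "ennreal (norm (cnj (G n x - h x) * h x)) = ennreal (norm (h x)) * ennreal (norm (G n x - h x))"
        by (simp add: norm_mult ennreal_mult mult.commute del: complex_cnj_diff)
      also have "\<dots> \<le> ennreal B * (\<integral>\<^sup>+z. ennreal (gauss_density z) * norm (h (x - z /\<^sub>R real (Suc n)) - h x) \<partial>lborel)"
        using B by (intro mult_mono * ennreal_leI) auto
      finally show "ennreal (norm (cnj (G n x - h x) * h x)) \<le> \<dots>" .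
    qed
    also have "\<dots> = ennreal B * (\<integral>\<^sup>+x. (\<integral>\<^sup>+z. ennreal (gauss_density z) * norm (h (x - z /\<^sub>R real (Suc n)) - h x) \<partial>lborel) \<partial>lborel)"
      by (rule nn_integral_cmult) (simp add: lborel.borel_measurable_nn_integral)
    also have "(\<integral>\<^sup>+x. (\<integral>\<^sup>+z. ennreal (gauss_density z) * norm (h (x - z /\<^sub>R real (Suc n)) - h x) \<partial>lborel) \<partial>lborel)
        = (\<integral>\<^sup>+z. (\<integral>\<^sup>+x. ennreal (gauss_density z) * norm (h (x - z /\<^sub>R real (Suc n)) - h x) \<partial>lborel) \<partial>lborel)"
      by (rule lborel_pair.Fubini') simp
    finally show ?thesis
      by (simp add: nn_integral_cmult)
  qed
  have "(\<lambda>n. ennreal (norm (complex_of_real (E n - I)))) \<longlonglongrightarrow> 0"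
  proof (rule tendsto_sandwich[OF _ _ tendsto_const])
    show "(\<lambda>n. ennreal B * (\<integral>\<^sup>+z. ennreal (gauss_density z) *
        (\<integral>\<^sup>+x. norm (h (x - z /\<^sub>R real (Suc n)) - h x) \<partial>lborel) \<partial>lborel)) \<longlonglongrightarrow> 0"
      using ennreal_tendsto_cmult[OF _ tendsto_gauss_average[OF h], of "ennreal B"] by simp
  qed (simp, intro always_eventually allI err)
  then have "(\<lambda>n. ennreal \<bar>E n - I\<bar>) \<longlonglongrightarrow> 0"
    by (simp only: norm_of_real)
  then have "E \<longlonglongrightarrow> I"
    by (simp add: tendsto_ennreal_iff[where x = 0, simplified] tendsto_rabs_zero_iff LIM_zero_iff)
  then have "(\<lambda>n. ennreal (E n)) \<longlonglongrightarrow> ennreal I"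
    by (rule tendsto_ennrealI)
  moreover have "(\<lambda>n. \<integral>\<^sup>+\<xi>. ennreal (k n \<xi> * (norm (fourier h \<xi>))\<^sup>2) \<partial>lborel) \<longlonglongrightarrow> (\<integral>\<^sup>+\<xi>. ennreal ((norm (fourier h \<xi>))\<^sup>2) \<partial>lborel)"
  proof (rule nn_integral_LIMSEQ)
    \<comment> \<open>The weights increase to 1, so monotone convergence applies before the
      unweighted energy is known to be finite.\<close>
    have "k m \<xi> \<le> k n \<xi>" if "m \<le> n" for m n \<xi>
      using that unfolding k_def by (auto intro!: divide_right_mono power_mono mult_right_mono mult_left_mono simp: field_simps)
    then show "incseq (\<lambda>n \<xi>. ennreal (k n \<xi> * (norm (fourier h \<xi>))\<^sup>2))"
      by (auto simp: incseq_def le_fun_def intro!: ennreal_leI mult_right_mono)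
    fix \<xi> :: "real^'n"
    have "(\<lambda>n. k n \<xi>) \<longlonglongrightarrow> exp (- ((norm ((2 * pi * 0) *\<^sub>R \<xi>))\<^sup>2 / 2))"
      unfolding k_def by (intro tendsto_intros LIMSEQ_inverse_real_of_nat) simp
    then have "(\<lambda>n. k n \<xi> * (norm (fourier h \<xi>))\<^sup>2) \<longlonglongrightarrow> 1 * (norm (fourier h \<xi>))\<^sup>2"
      by (intro tendsto_mult tendsto_const) simp
    then show "(\<lambda>n. ennreal (k n \<xi> * (norm (fourier h \<xi>))\<^sup>2)) \<longlonglongrightarrow> ennreal ((norm (fourier h \<xi>))\<^sup>2)"
      by (intro tendsto_ennrealI) simp
  qed simp
  moreover have "(\<integral>\<^sup>+\<xi>. ennreal (k n \<xi> * (norm (fourier h \<xi>))\<^sup>2) \<partial>lborel) = ennreal (E n)" for n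
    unfolding E_def using intk by (intro nn_integral_eq_integral) (auto simp: k_def)
  ultimately have "(\<integral>\<^sup>+\<xi>. ennreal ((norm (fourier h \<xi>))\<^sup>2) \<partial>lborel) = ennreal I"
    using LIMSEQ_unique by simp
  also have "\<dots> = (\<integral>\<^sup>+x. ennreal ((norm (h x))\<^sup>2) \<partial>lborel)"
    unfolding I_def using h2 by (intro nn_integral_eq_integral[symmetric]) auto
  finally show ?thesis .
qed

subsection \<open>Convolution with a partition of unity in frequency\<close>

lemma conv_lborel:
  assumes [measurable]: "h \<in> borel_measurable borel" "f \<in> borel_measurable borel"
  shows "conv h f x = (LINT y|lborel. h y * f (x - y))"
  unfolding conv_def by (rule integral_completion) simp

lemma borel_measurable_conv:
  assumes [measurable]: "h \<in> borel_measurable borel" "f \<in> borel_measurable borel"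
  shows "conv h f \<in> borel_measurable borel"
proof -
  have "(\<lambda>x. LINT y|lborel. h y * f (x - y)) \<in> borel_measurable borel"
    by (intro lborel.borel_measurable_lebesgue_integral) simp
  then show ?thesis
    by (simp add: conv_lborel[OF assms] fun_eq_iff[symmetric] cong: measurable_cong)
qed

lemma
  fixes u :: "'a::euclidean_space \<Rightarrow> 'b::{banach, second_countable_topology}"
  assumes [measurable]: "u \<in> borel_measurable borel"
  shows integrable_lborel_minus: "integrable lborel (\<lambda>y. u (x - y)) \<longleftrightarrow> integrable lborel u"
    and integral_lborel_minus: "(LINT y|lborel. u (x - y)) = (LINT y|lborel. u y)"
    and integrable_lborel_translate: "integrable lborel (\<lambda>y. u (y - x)) \<longleftrightarrow> integrable lborel u"
    and integral_lborel_translate: "(LINT y|lborel. u (y - x)) = (LINT y|lborel. u y)"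
  using integrable_lborel_affine[of "-1" u x] integral_lborel_affine[of "-1" u x]
    integrable_lborel_affine[of 1 u "- x"] integral_lborel_affine[of 1 u "- x"] by simp_all

lemma norm_mult_le_sum_squares: "norm (a * b :: complex) \<le> (norm a)\<^sup>2 + (norm b)\<^sup>2"
  using sum_squares_bound[of "norm a" "norm b"] mult_nonneg_nonneg[OF norm_ge_zero[of a] norm_ge_zero[of b]]
  unfolding norm_mult by linarith

text \<open>A crude substitute for the Cauchy-Schwarz bound. It is enough here that the bound is
  finite and does not depend on \<open>x\<close>: this is the boundedness that
  \<open>plancherel_bounded\<close> demands of a convolution.\<close>

lemma
  assumes [measurable]: "h \<in> borel_measurable borel" "f \<in> borel_measurable borel"
    and h: "integrable lborel (\<lambda>x. (norm (h x))\<^sup>2)" and f: "integrable lborel (\<lambda>x. (norm (f x))\<^sup>2)"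
  shows integrable_conv_integrand: "integrable lborel (\<lambda>y. h y * f (x - y))"
    and norm_conv_le: "norm (conv h f x) \<le> (LINT x|lborel. (norm (h x))\<^sup>2) + (LINT x|lborel. (norm (f x))\<^sup>2)"
proof -
  have f': "integrable lborel (\<lambda>y. (norm (f (x - y)))\<^sup>2)"
    using f integrable_lborel_minus[of "\<lambda>x. (norm (f x))\<^sup>2" x] by simp
  show int: "integrable lborel (\<lambda>y. h y * f (x - y))"
  proof (rule Bochner_Integration.integrable_bound)
    show "integrable lborel (\<lambda>y. (norm (h y))\<^sup>2 + (norm (f (x - y)))\<^sup>2)"
      using h f' by simp
    show "AE y in lborel. norm (h y * f (x - y)) \<le> norm ((norm (h y))\<^sup>2 + (norm (f (x - y)))\<^sup>2)"
      using norm_mult_le_sum_squares by (auto intro: order_trans)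
  qed simp
  have "norm (conv h f x) \<le> (LINT y|lborel. norm (h y * f (x - y)))"
    unfolding conv_lborel[OF assms(1,2)] by (rule integral_norm_bound)
  also have "\<dots> \<le> (LINT y|lborel. (norm (h y))\<^sup>2 + (norm (f (x - y)))\<^sup>2)"
    using int h f' by (intro Bochner_Integration.integral_mono norm_mult_le_sum_squares) auto
  also have "\<dots> = (LINT x|lborel. (norm (h x))\<^sup>2) + (LINT x|lborel. (norm (f x))\<^sup>2)"
    using h f' integral_lborel_minus[of "\<lambda>x. (norm (f x))\<^sup>2" x] by simp
  finally show "norm (conv h f x) \<le> (LINT x|lborel. (norm (h x))\<^sup>2) + (LINT x|lborel. (norm (f x))\<^sup>2)" .
qed

lemma
  fixes h f :: "real^'n \<Rightarrow> complex"
  assumes h: "integrable lborel h" and f: "integrable lborel f"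
  shows integrable_conv: "integrable lborel (conv h f)"
    and fourier_conv: "fourier (conv h f) \<xi> = fourier h \<xi> * fourier f \<xi>"
proof -
  have [measurable]: "h \<in> borel_measurable borel" "f \<in> borel_measurable borel"
    using borel_measurable_integrable[OF h] borel_measurable_integrable[OF f] by simp_all
  have int: "integrable (lborel \<Otimes>\<^sub>M lborel) (\<lambda>(y, x). h y * f (x - y))"
  proof (rule lborel_pair.Fubini_integrable)
    have "(LINT x|lborel. norm (h y * f (x - y))) = norm (h y) * (LINT x|lborel. norm (f x))" for y
      using integral_lborel_translate[of "\<lambda>x. norm (f x)" y] by (simp add: norm_mult)
    then show "integrable lborel (\<lambda>y. LINT x|lborel. norm (case (y, x) of (y, x) \<Rightarrow> h y * f (x - y)))"
      using h by simp
    show "AE y in lborel. integrable lborel (\<lambda>x. case (y, x) of (y, x) \<Rightarrow> h y * f (x - y))"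
      using f integrable_lborel_translate[of f] by simp
  qed simp
  show "integrable lborel (conv h f)"
  proof -
    have "conv h f = (\<lambda>x. LINT y|lborel. h y * f (x - y))"
      by (rule ext) (simp add: conv_lborel)
    then show ?thesis
      using lborel_pair.integrable_snd[OF int] by simp
  qed
  let ?F = "\<lambda>y x. h y * f (x - y) * cis (- 2 * pi * (x \<bullet> \<xi>))"
  have int': "integrable (lborel \<Otimes>\<^sub>M lborel) (case_prod ?F)"
    using integrable_mult_cis[OF int, of "\<lambda>z. - 2 * pi * (snd z \<bullet> \<xi>)"] by (simp add: case_prod_beta')
  have "fourier (conv h f) \<xi> = (LINT x|lborel. LINT y|lborel. ?F y x)"
    by (simp add: fourier_lborel borel_measurable_conv conv_lborel)
  also have "\<dots> = (LINT y|lborel. LINT x|lborel. ?F y x)"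
    by (rule lborel_pair.Fubini_integral[OF int'])
  also have "\<dots> = (LINT y|lborel. h y * cis (- 2 * pi * (y \<bullet> \<xi>)) * fourier f \<xi>)"
  proof (intro Bochner_Integration.integral_cong refl)
    fix y
    \<comment> \<open>The character at \<open>x\<close> factors into those at \<open>y\<close> and
      at \<open>x - y\<close>; after a translation the second factor produces
      \<open>fourier f\<close>.\<close>
    have "(LINT x|lborel. ?F y x) = (LINT x|lborel. h y * cis (- 2 * pi * (y \<bullet> \<xi>)) * (f (x - y) * cis (- 2 * pi * ((x - y) \<bullet> \<xi>))))"
      by (intro Bochner_Integration.integral_cong refl)
         (simp add: cis_mult mult.left_commute[of "cis _" "f _"] mult.assoc inner_diff_left algebra_simps)
    also have "\<dots> = h y * cis (- 2 * pi * (y \<bullet> \<xi>)) * (LINT x|lborel. f (x - y) * cis (- 2 * pi * ((x - y) \<bullet> \<xi>)))"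
      by (rule integral_mult_right_zero)
    also have "(LINT x|lborel. f (x - y) * cis (- 2 * pi * ((x - y) \<bullet> \<xi>))) = fourier f \<xi>"
      using integral_lborel_translate[of "\<lambda>x. f x * cis (- 2 * pi * (x \<bullet> \<xi>))" y] by (simp add: fourier_lborel)
    finally show "(LINT x|lborel. ?F y x) = h y * cis (- 2 * pi * (y \<bullet> \<xi>)) * fourier f \<xi>" .
  qed
  also have "\<dots> = fourier h \<xi> * fourier f \<xi>"
    unfolding integral_mult_left_zero by (simp add: fourier_lborel)
  finally show "fourier (conv h f) \<xi> = fourier h \<xi> * fourier f \<xi>" .
qed

text \<open>Integrability of both functions makes the convolution integrable, square integrability
  makes it bounded, so Plancherel applies to the convolution itself.\<close>

lemma nn_integral_conv_square:
  fixes h f :: "real^'n \<Rightarrow> complex"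
  assumes "integrable lborel h" and "integrable lborel (\<lambda>x. (norm (h x))\<^sup>2)"
    and "integrable lborel f" and "integrable lborel (\<lambda>x. (norm (f x))\<^sup>2)"
  shows "(\<integral>\<^sup>+x. ennreal ((norm (conv h f x))\<^sup>2) \<partial>lborel)
    = (\<integral>\<^sup>+\<xi>. ennreal ((norm (fourier h \<xi>))\<^sup>2) * ennreal ((norm (fourier f \<xi>))\<^sup>2) \<partial>lborel)"
proof -
  have "h \<in> borel_measurable borel" "f \<in> borel_measurable borel"
    using assms(1,3)[THEN borel_measurable_integrable] by simp_all
  then show ?thesis
    using plancherel_bounded[OF integrable_conv norm_conv_le, of h f] assms
    by (simp add: fourier_conv norm_mult power_mult_distrib ennreal_mult)
qed

text \<open>On the frequency side Tonelli moves the sum over \<open>p\<close> inside, where it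
  equals 1 at every frequency; Plancherel for \<open>h\<close> then returns to the space
  side.\<close>

lemma nn_integral_conv_family_bounded:
  fixes f :: "'i \<Rightarrow> real^'n \<Rightarrow> complex"
  assumes "countable I"
    and f: "\<And>p. p \<in> I \<Longrightarrow> integrable lborel (f p)" "\<And>p. p \<in> I \<Longrightarrow> integrable lborel (\<lambda>x. (norm (f p x))\<^sup>2)"
    and partition: "\<And>\<xi>. (\<integral>\<^sup>+p. ennreal ((norm (fourier (f p) \<xi>))\<^sup>2) \<partial>count_space I) = 1"
    and h: "integrable lborel h" and B: "\<And>x. norm (h x) \<le> B"
  shows "(\<integral>\<^sup>+p. \<integral>\<^sup>+x. ennreal ((norm (conv h (f p) x))\<^sup>2) \<partial>lborel \<partial>count_space I)
    = (\<integral>\<^sup>+x. ennreal ((norm (h x))\<^sup>2) \<partial>lborel)"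
proof -
  have B0: "B \<ge> 0"
    using B[of undefined] norm_ge_zero order_trans by blast
  have [measurable]: "h \<in> borel_measurable borel"
    using borel_measurable_integrable[OF h] by simp
  note [measurable] = borel_measurable_fourier[of h]
  have fm[measurable]: "fourier (f p) \<in> borel_measurable borel" if "p \<in> I" for p
    using borel_measurable_integrable[OF f(1)[OF that]] by (simp add: borel_measurable_fourier)
  have h2: "integrable lborel (\<lambda>x. (norm (h x))\<^sup>2)"
  proof (rule Bochner_Integration.integrable_bound)
    show "integrable lborel (\<lambda>x. B * norm (h x))"
      using h by simp
    show "AE x in lborel. norm ((norm (h x))\<^sup>2) \<le> norm (B * norm (h x))"
      using B B0 by (auto simp: power2_eq_square abs_mult intro!: mult_right_mono)
  qed simp
  have "(\<integral>\<^sup>+p. \<integral>\<^sup>+x. ennreal ((norm (conv h (f p) x))\<^sup>2) \<partial>lborel \<partial>count_space I)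
      = (\<integral>\<^sup>+p. \<integral>\<^sup>+\<xi>. ennreal ((norm (fourier h \<xi>))\<^sup>2) * ennreal ((norm (fourier (f p) \<xi>))\<^sup>2) \<partial>lborel \<partial>count_space I)"
    by (rule nn_integral_cong) (simp add: nn_integral_conv_square[OF h h2] f)
  also have "\<dots> = (\<integral>\<^sup>+\<xi>. \<integral>\<^sup>+p. ennreal ((norm (fourier h \<xi>))\<^sup>2) * ennreal ((norm (fourier (f p) \<xi>))\<^sup>2) \<partial>count_space I \<partial>lborel)"
    using \<open>countable I\<close> by (intro nn_integral_count_space_nn_integral[symmetric]) auto
  also have "\<dots> = (\<integral>\<^sup>+\<xi>. ennreal ((norm (fourier h \<xi>))\<^sup>2) \<partial>lborel)"
    by (simp add: nn_integral_cmult partition)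
  finally show ?thesis
    using plancherel_bounded[OF h B] by simp
qed

section \<open>From bounded integrable functions to all of L^2\<close>

text \<open>The weighted form of \<open>2 * a * b \<le> a\<^sup>2 + b\<^sup>2\<close>. A small
  \<open>\<delta>\<close> keeps the coefficient of the main term near 1, at the price of a large one
  on a term that will tend to 0.\<close>

lemma norm_diff_square_le:
  fixes a b :: complex
  assumes "\<delta> > 0"
  shows "(norm (a - b))\<^sup>2 \<le> (1 + \<delta>) * (norm a)\<^sup>2 + (1 + 1 / \<delta>) * (norm b)\<^sup>2"
proof -
  have "(norm (a - b))\<^sup>2 \<le> (norm a + norm b)\<^sup>2"
    by (intro power_mono norm_triangle_ineq4) simp
  also have "\<dots> = (1 + \<delta>) * (norm a)\<^sup>2 + (1 + 1 / \<delta>) * (norm b)\<^sup>2 - (\<delta> * norm a - norm b)\<^sup>2 / \<delta>"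
    using assms by (simp add: field_simps power2_eq_square)
  also have "\<dots> \<le> (1 + \<delta>) * (norm a)\<^sup>2 + (1 + 1 / \<delta>) * (norm b)\<^sup>2"
    using assms by simp
  finally show ?thesis .
qed

text \<open>The analysis map is isometric on bounded functions of bounded support.  Fatou's lemma along
  truncations extends the upper bound to \<open>L\<^sup>2\<close>; the upper bound for the tails then gives the lower bound.\<close>

theorem nn_integral_conv_family:
  fixes f :: "'i \<Rightarrow> real^'n \<Rightarrow> complex"
  assumes I: "countable I"
    and f: "\<And>p. p \<in> I \<Longrightarrow> integrable lborel (f p)" "\<And>p. p \<in> I \<Longrightarrow> integrable lborel (\<lambda>x. (norm (f p x))\<^sup>2)"
    and partition: "\<And>\<xi>. (\<integral>\<^sup>+p. ennreal ((norm (fourier (f p) \<xi>))\<^sup>2) \<partial>count_space I) = 1"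
    and hm: "h \<in> borel_measurable borel" and h: "integrable lborel (\<lambda>x. (norm (h x))\<^sup>2)"
  shows "(\<integral>\<^sup>+p. \<integral>\<^sup>+x. ennreal ((norm (conv h (f p) x))\<^sup>2) \<partial>lborel \<partial>count_space I)
    = (\<integral>\<^sup>+x. ennreal ((norm (h x))\<^sup>2) \<partial>lborel)"
proof -
  define N where "N u = (\<integral>\<^sup>+p. \<integral>\<^sup>+x. ennreal ((norm (conv u (f p) x))\<^sup>2) \<partial>lborel \<partial>count_space I)" for u
  \<comment> \<open>Cutting both the domain and the values makes \<open>T n u\<close> bounded with
    bounded support, hence integrable whenever \<open>u\<close> is Borel.\<close>
  define T where "T n u = (\<lambda>x. if norm x \<le> real n \<and> norm (u x) \<le> real n then u x else 0)"
    for n and u :: "real^'n \<Rightarrow> complex"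
  have fm[measurable]: "f p \<in> borel_measurable borel" if "p \<in> I" for p
    using borel_measurable_integrable[OF f(1)[OF that]] by simp
  have Tm[measurable]: "T n u \<in> borel_measurable borel" if [measurable]: "u \<in> borel_measurable borel" for n u
    unfolding T_def by measurable
  have Tle: "norm (T n u x) \<le> norm (u x)" for n u x
    by (simp add: T_def)
  have Tlim: "(\<lambda>n. T n u x) \<longlonglongrightarrow> u x" for u x
  proof (rule tendsto_eventually)
    obtain n where "max (norm x) (norm (u x)) \<le> real n"
      using real_arch_simple by blast
    then show "eventually (\<lambda>n. T n u x = u x) sequentially"
      unfolding T_def eventually_sequentially by (intro exI[of _ n]) auto
  qed
  have NT: "N (T n u) = (\<integral>\<^sup>+x. ennreal ((norm (T n u x))\<^sup>2) \<partial>lborel)"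
    if [measurable]: "u \<in> borel_measurable borel" for n u
    unfolding N_def
  proof (rule nn_integral_conv_family_bounded[OF I f partition])
    show "norm (T n u x) \<le> real n" for x
      by (simp add: T_def)
    show "integrable lborel (T n u)"
    proof (rule Bochner_Integration.integrable_bound)
      show "integrable lborel (\<lambda>x. indicator (cball 0 (real n)) x * real n)"
        using emeasure_bounded_finite[OF bounded_cball, of 0 "real n"]
        by (intro integrable_mult_left) (simp add: integrable_indicator_iff)
    qed (auto simp: T_def indicator_def)
  qed
  have upper: "N u \<le> (\<integral>\<^sup>+x. ennreal ((norm (u x))\<^sup>2) \<partial>lborel)"
    if um[measurable]: "u \<in> borel_measurable borel" and u: "integrable lborel (\<lambda>x. (norm (u x))\<^sup>2)" for u
  proof -
    \<comment> \<open>Convergence holds at every \<open>x\<close>: the product of \<open>u\<close>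
      with a reflected translate of \<open>f p\<close> is integrable and dominates the truncated
      integrands.\<close>
    have lim: "(\<lambda>n. conv (T n u) (f p) x) \<longlonglongrightarrow> conv u (f p) x" if p: "p \<in> I" for p x
      unfolding conv_lborel[OF um fm[OF p]] conv_lborel[OF Tm[OF um] fm[OF p]]
    proof (rule integral_dominated_convergence)
      note [measurable] = fm[OF p]
      show "(\<lambda>y. u y * f p (x - y)) \<in> borel_measurable lborel" "(\<lambda>y. T n u y * f p (x - y)) \<in> borel_measurable lborel" for n
        by simp_all
      show "integrable lborel (\<lambda>y. norm (u y * f p (x - y)))"
        by (intro integrable_norm integrable_conv_integrand um fm u f p)
      show "AE y in lborel. (\<lambda>n. T n u y * f p (x - y)) \<longlonglongrightarrow> u y * f p (x - y)"
        by (intro AE_I2 tendsto_mult tendsto_const Tlim)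
      show "AE y in lborel. norm (T n u y * f p (x - y)) \<le> norm (u y * f p (x - y))" for n
        by (auto simp: norm_mult intro!: mult_right_mono Tle)
    qed
    have "(\<integral>\<^sup>+x. ennreal ((norm (conv u (f p) x))\<^sup>2) \<partial>lborel)
        \<le> liminf (\<lambda>n. \<integral>\<^sup>+x. ennreal ((norm (conv (T n u) (f p) x))\<^sup>2) \<partial>lborel)" if p: "p \<in> I" for p
    proof -
      note [measurable] = fm[OF p] borel_measurable_conv[OF Tm[OF um] fm[OF p]]
      have "(\<lambda>n. ennreal ((norm (conv (T n u) (f p) x))\<^sup>2)) \<longlonglongrightarrow> ennreal ((norm (conv u (f p) x))\<^sup>2)" for x
        by (intro tendsto_ennrealI tendsto_power tendsto_norm lim p)
      then have "(\<integral>\<^sup>+x. ennreal ((norm (conv u (f p) x))\<^sup>2) \<partial>lborel)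
          = (\<integral>\<^sup>+x. liminf (\<lambda>n. ennreal ((norm (conv (T n u) (f p) x))\<^sup>2)) \<partial>lborel)"
        by (intro nn_integral_cong lim_imp_Liminf[symmetric]) auto
      also have "\<dots> \<le> liminf (\<lambda>n. \<integral>\<^sup>+x. ennreal ((norm (conv (T n u) (f p) x))\<^sup>2) \<partial>lborel)"
        by (rule nn_integral_liminf) simp
      finally show ?thesis .
    qed
    then have "N u \<le> (\<integral>\<^sup>+p. liminf (\<lambda>n. \<integral>\<^sup>+x. ennreal ((norm (conv (T n u) (f p) x))\<^sup>2) \<partial>lborel) \<partial>count_space I)"
      unfolding N_def by (intro nn_integral_mono) simp
    \<comment> \<open>Fatou a second time, now for counting measure on \<open>I\<close>; the first
      use was in the space variable for each fixed \<open>p\<close>.\<close>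
    also have "\<dots> \<le> liminf (\<lambda>n. N (T n u))"
      unfolding N_def by (rule nn_integral_liminf) simp
    also have "\<dots> \<le> (\<integral>\<^sup>+x. ennreal ((norm (u x))\<^sup>2) \<partial>lborel)"
      unfolding NT[OF um]
      by (intro Liminf_le always_eventually allI nn_integral_mono ennreal_leI power_mono Tle) auto
    finally show ?thesis .
  qed
  \<comment> \<open>For fixed \<open>\<delta>\<close>, the truncation is \<open>h\<close> minus the
    tail \<open>r n\<close>. Its energy is known exactly from \<open>NT\<close>, the tail
    contributes at most a constant times its L^2 energy by \<open>upper\<close>, and that energy
    tends to 0 by dominated convergence.\<close>
  have lower: "(\<integral>\<^sup>+x. ennreal ((norm (h x))\<^sup>2) \<partial>lborel) \<le> ennreal (1 + \<delta>) * N h" if "\<delta> > 0" for \<delta>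
  proof (rule LIMSEQ_le)
    define r where "r n x = h x - T n h x" for n x
    have rm[measurable]: "r n \<in> borel_measurable borel" for n
      using hm unfolding r_def by measurable
    have rle: "norm (r n x) \<le> norm (h x)" for n x
      by (simp add: r_def T_def)
    have r2: "integrable lborel (\<lambda>x. (norm (r n x))\<^sup>2)" for n
      by (rule Bochner_Integration.integrable_bound[OF h]) (auto intro!: power_mono rle)
    have T2: "integrable lborel (\<lambda>x. (norm (T n h x))\<^sup>2)" for n
      using hm by (intro Bochner_Integration.integrable_bound[OF h]) (auto intro!: power_mono Tle)
    have hfin: "(\<integral>\<^sup>+x. ennreal ((norm (h x))\<^sup>2) \<partial>lborel) < \<infinity>"
      using h by (simp add: integrable_iff_bounded)
    show "(\<lambda>n. \<integral>\<^sup>+x. ennreal ((norm (T n h x))\<^sup>2) \<partial>lborel) \<longlonglongrightarrow> (\<integral>\<^sup>+x. ennreal ((norm (h x))\<^sup>2) \<partial>lborel)"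
      using hm hfin
      by (intro nn_integral_dominated_convergence[where w = "\<lambda>x. ennreal ((norm (h x))\<^sup>2)"])
         (auto intro!: power_mono Tle tendsto_intros Tlim ennreal_leI)
    have "(\<lambda>n. \<integral>\<^sup>+x. ennreal ((norm (r n x))\<^sup>2) \<partial>lborel) \<longlonglongrightarrow> (\<integral>\<^sup>+(x::real^'n). ennreal ((norm (0::complex))\<^sup>2) \<partial>lborel)"
    proof (rule nn_integral_dominated_convergence[where w = "\<lambda>x. ennreal ((norm (h x))\<^sup>2)"])
      have "(\<lambda>n. r n x) \<longlonglongrightarrow> 0" for x
        unfolding r_def using tendsto_diff[OF tendsto_const Tlim, of "h x" h x] by simp
      then show "AE x in lborel. (\<lambda>n. ennreal ((norm (r n x))\<^sup>2)) \<longlonglongrightarrow> ennreal ((norm (0::complex))\<^sup>2)"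
        by (intro AE_I2 tendsto_ennrealI tendsto_power tendsto_norm)
    qed (use hm hfin in \<open>auto intro!: power_mono rle ennreal_leI\<close>)
    then have "(\<lambda>n. ennreal (1 + \<delta>) * N h + ennreal (1 + 1 / \<delta>) * (\<integral>\<^sup>+x. ennreal ((norm (r n x))\<^sup>2) \<partial>lborel))
        \<longlonglongrightarrow> ennreal (1 + \<delta>) * N h + ennreal (1 + 1 / \<delta>) * 0"
      by (intro tendsto_add tendsto_const ennreal_tendsto_cmult) auto
    then show "(\<lambda>n. ennreal (1 + \<delta>) * N h + ennreal (1 + 1 / \<delta>) * (\<integral>\<^sup>+x. ennreal ((norm (r n x))\<^sup>2) \<partial>lborel))
        \<longlonglongrightarrow> ennreal (1 + \<delta>) * N h"
      by simp
    have "(\<integral>\<^sup>+x. ennreal ((norm (T n h x))\<^sup>2) \<partial>lborel)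
        \<le> ennreal (1 + \<delta>) * N h + ennreal (1 + 1 / \<delta>) * (\<integral>\<^sup>+x. ennreal ((norm (r n x))\<^sup>2) \<partial>lborel)" for n
    proof -
      have split: "conv (T n h) (f p) x = conv h (f p) x - conv (r n) (f p) x" if p: "p \<in> I" for p x
      proof -
        have "conv h (f p) x - conv (r n) (f p) x = (LINT y|lborel. h y * f p (x - y) - r n y * f p (x - y))"
          unfolding conv_lborel[OF hm fm[OF p]] conv_lborel[OF rm fm[OF p]]
          by (intro Bochner_Integration.integral_diff[symmetric] integrable_conv_integrand hm rm fm f h r2 p)
        also have "\<dots> = conv (T n h) (f p) x"
          unfolding conv_lborel[OF Tm[OF hm] fm[OF p]] r_def by (simp add: left_diff_distrib)
        finally show ?thesis ..
      qed
      have "N (T n h) \<le> (\<integral>\<^sup>+p. ennreal (1 + \<delta>) * (\<integral>\<^sup>+x. ennreal ((norm (conv h (f p) x))\<^sup>2) \<partial>lborel)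
          + ennreal (1 + 1 / \<delta>) * (\<integral>\<^sup>+x. ennreal ((norm (conv (r n) (f p) x))\<^sup>2) \<partial>lborel) \<partial>count_space I)"
        unfolding N_def
      proof (rule nn_integral_mono)
        fix p assume "p \<in> space (count_space I)"
        then have p: "p \<in> I" by simp
        note [measurable] = borel_measurable_conv[OF hm fm[OF p]] borel_measurable_conv[OF rm fm[OF p]]
        have "(\<integral>\<^sup>+x. ennreal ((norm (conv (T n h) (f p) x))\<^sup>2) \<partial>lborel)
            \<le> (\<integral>\<^sup>+x. ennreal (1 + \<delta>) * ennreal ((norm (conv h (f p) x))\<^sup>2)
              + ennreal (1 + 1 / \<delta>) * ennreal ((norm (conv (r n) (f p) x))\<^sup>2) \<partial>lborel)"
          using norm_diff_square_le[OF \<open>\<delta> > 0\<close>] \<open>\<delta> > 0\<close>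
          by (intro nn_integral_mono) (simp add: split[OF p] flip: ennreal_mult ennreal_plus)
        also have "\<dots> = ennreal (1 + \<delta>) * (\<integral>\<^sup>+x. ennreal ((norm (conv h (f p) x))\<^sup>2) \<partial>lborel)
            + ennreal (1 + 1 / \<delta>) * (\<integral>\<^sup>+x. ennreal ((norm (conv (r n) (f p) x))\<^sup>2) \<partial>lborel)"
          by (simp add: nn_integral_add nn_integral_cmult)
        finally show "(\<integral>\<^sup>+x. ennreal ((norm (conv (T n h) (f p) x))\<^sup>2) \<partial>lborel) \<le> \<dots>" .
      qed
      also have "\<dots> = ennreal (1 + \<delta>) * N h + ennreal (1 + 1 / \<delta>) * N (r n)"
        unfolding N_def by (simp add: nn_integral_add nn_integral_cmult)
      also have "\<dots> \<le> ennreal (1 + \<delta>) * N h + ennreal (1 + 1 / \<delta>) * (\<integral>\<^sup>+x. ennreal ((norm (r n x))\<^sup>2) \<partial>lborel)"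
        by (intro add_left_mono mult_left_mono upper rm r2) simp
      finally show ?thesis
        unfolding NT[OF hm] .
    qed
    then show "\<exists>n0. \<forall>n\<ge>n0. (\<integral>\<^sup>+x. ennreal ((norm (T n h x))\<^sup>2) \<partial>lborel)
        \<le> ennreal (1 + \<delta>) * N h + ennreal (1 + 1 / \<delta>) * (\<integral>\<^sup>+x. ennreal ((norm (r n x))\<^sup>2) \<partial>lborel)"
      by blast
  qed
  have "(\<integral>\<^sup>+x. ennreal ((norm (h x))\<^sup>2) \<partial>lborel) \<le> N h"
  proof (rule LIMSEQ_le_const)
    \<comment> \<open>Now \<open>\<delta>\<close> runs through 1/(n+1); finiteness of
      \<open>N h\<close> lets the factor pass to the limit in the extended reals.\<close>
    have "N h < \<infinity>"
      using upper[OF hm h] h by (auto simp: integrable_iff_bounded intro: le_less_trans)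
    have "(\<lambda>n. ennreal (1 + inverse (real (Suc n)))) \<longlonglongrightarrow> ennreal (1 + 0)"
      by (intro tendsto_ennrealI tendsto_add tendsto_const LIMSEQ_inverse_real_of_nat)
    then show "(\<lambda>n. N h * ennreal (1 + inverse (real (Suc n)))) \<longlonglongrightarrow> N h"
      using ennreal_tendsto_cmult[of "N h"] \<open>N h < \<infinity>\<close> by fastforce
    show "\<exists>n0. \<forall>n\<ge>n0. (\<integral>\<^sup>+x. ennreal ((norm (h x))\<^sup>2) \<partial>lborel) \<le> N h * ennreal (1 + inverse (real (Suc n)))"
      using lower by (simp add: mult.commute)
  qed
  then show ?thesis
    using upper[OF hm h] unfolding N_def by (rule antisym[rotated])
qed

subsection \<open>Semi-discrete Parseval frames\<close>

text \<open>The bridge between counting-measure integrals, in which the estimates are made, and the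
  unordered sums of the frame definitions. Because \<open>ennreal s\<close> is finite, an integral
  equal to it already contains summability.\<close>

lemma nn_integral_count_space_eq_ennreal_iff:
  fixes a :: "'i \<Rightarrow> real"
  assumes a: "\<And>i. i \<in> I \<Longrightarrow> a i \<ge> 0" and "s \<ge> 0"
  shows "(\<integral>\<^sup>+i. ennreal (a i) \<partial>count_space I) = ennreal s \<longleftrightarrow> (a has_sum s) I"
proof -
  have eqv: "a summable_on I \<longleftrightarrow> integrable (count_space I) a"
  proof -
    have "a summable_on I \<longleftrightarrow> (\<lambda>i. norm (a i)) summable_on I"
      by (rule summable_on_iff_abs_summable_on_real)
    also have "\<dots> \<longleftrightarrow> integrable (count_space I) a"
      unfolding abs_summable_equivalent by (rule abs_summable_on_def)
    finally show ?thesis .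
  qed
  have sum: "(\<integral>\<^sup>+i. ennreal (a i) \<partial>count_space I) = ennreal (infsum a I)" if "a summable_on I"
  proof -
    have abs: "Infinite_Set_Sum.abs_summable_on a I"
      unfolding abs_summable_on_def using that by (simp only: eqv)
    show ?thesis
      unfolding infsetsum_infsum[OF abs, symmetric]
      by (rule nn_integral_conv_infsetsum[OF abs]) (rule a)
  qed
  show ?thesis
  proof
    assume eq: "(\<integral>\<^sup>+i. ennreal (a i) \<partial>count_space I) = ennreal s"
    then have "a summable_on I"
      unfolding eqv by (intro integrableI_nonneg) (simp_all add: AE_count_space a)
    moreover from this have "infsum a I = s"
      using sum eq \<open>s \<ge> 0\<close> infsum_nonneg[of I a] a by simp
    ultimately show "(a has_sum s) I"
      using has_sum_infsum by blast
  next
    assume s: "(a has_sum s) I"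
    then show "(\<integral>\<^sup>+i. ennreal (a i) \<partial>count_space I) = ennreal s"
      using sum[OF has_sum_imp_summable[OF s]] infsumI[OF s] by simp
  qed
qed

text \<open>Separates off the window's term, which the frame definitions list outside the sum over
  \<open>P\<close>.\<close>

lemma has_sum_insertD:
  fixes a :: "'i \<Rightarrow> real"
  assumes "(a has_sum s) (insert z P)" and "z \<notin> P"
  shows "a summable_on P" and "a z + infsum a P = s"
proof -
  show "a summable_on P"
    using has_sum_imp_summable[OF assms(1)] by (rule summable_on_subset) auto
  then show "a z + infsum a P = s"
    using infsum_insert[of a P z] infsumI[OF assms(1)] assms(2) by simp
qed

section \<open>Borel representatives and the Parseval criterion\<close>

text \<open>Supplies the Borel version of an L^2 function that is only Lebesgue measurable; the real
  and imaginary parts are treated separately.\<close>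

lemma lebesgue_measurable_AE_eq_borel:
  fixes h :: "'a::euclidean_space \<Rightarrow> complex"
  assumes "h \<in> borel_measurable lebesgue"
  obtains h' where "h' \<in> borel_measurable borel" and "AE x in lebesgue. h x = h' x"
proof -
  have "(\<lambda>x. Re (h x)) \<in> borel_measurable lebesgue" "(\<lambda>x. Im (h x)) \<in> borel_measurable lebesgue"
    using assms by simp_all
  from this[THEN completion_ex_borel_measurable_real]
  obtain u v where "u \<in> borel_measurable lborel" "AE x in lborel. Re (h x) = u x"
    and "v \<in> borel_measurable lborel" "AE x in lborel. Im (h x) = v x" by blast
  then have "(\<lambda>x. Complex (u x) (v x)) \<in> borel_measurable borel"
    and "AE x in lborel. h x = Complex (u x) (v x)"
    by (auto simp: borel_measurable_complex_iff complex_eq_iff)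
  then show ?thesis
    using that AE_completion by blast
qed

lemma borel_imp_lebesgue_measurable:
  "f \<in> borel_measurable borel \<Longrightarrow> f \<in> borel_measurable lebesgue"
  by (rule measurable_completion) simp

lemma in_L1_borel_iff:
  "f \<in> borel_measurable borel \<Longrightarrow> in_L1 f \<longleftrightarrow> integrable lborel f"
  unfolding in_L1_def by (rule integrable_completion) simp

lemma in_L2_borel_iff:
  assumes [measurable]: "f \<in> borel_measurable borel"
  shows "in_L2 f \<longleftrightarrow> integrable lborel (\<lambda>x. (norm (f x))\<^sup>2)"
proof -
  have "integrable lebesgue (\<lambda>x. (norm (f x))\<^sup>2) \<longleftrightarrow> integrable lborel (\<lambda>x. (norm (f x))\<^sup>2)"
    by (rule integrable_completion) simp
  then show ?thesis
    unfolding in_L2_def using borel_imp_lebesgue_measurable[OF assms] by simp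
qed

lemma ennreal_L2_norm_square:
  assumes [measurable]: "f \<in> borel_measurable borel" and "in_L2 f"
  shows "ennreal ((L2_norm f)\<^sup>2) = (\<integral>\<^sup>+x. ennreal ((norm (f x))\<^sup>2) \<partial>lborel)"
proof -
  have "(L2_norm f)\<^sup>2 = (LINT x|lborel. (norm (f x))\<^sup>2)"
    unfolding L2_norm_def by (simp add: integral_completion)
  then show ?thesis
    using assms(2) by (simp add: in_L2_borel_iff nn_integral_eq_integral)
qed

text \<open>The extra index \<open>z\<close> stands for the window, so that the whole family is
  indexed by one countable set and the partition of unity is a single sum.\<close>

theorem semidiscrete_parseval_frameI:
  fixes f :: "'p \<Rightarrow> real^'n \<Rightarrow> complex"
  assumes "countable P" and z: "z \<notin> P"
    and fm: "\<And>p. p \<in> insert z P \<Longrightarrow> f p \<in> borel_measurable borel"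
    and f1: "\<And>p. p \<in> insert z P \<Longrightarrow> in_L1 (f p)" and f2: "\<And>p. p \<in> insert z P \<Longrightarrow> in_L2 (f p)"
    and partition: "\<And>\<xi>. ((\<lambda>p. (norm (fourier (f p) \<xi>))\<^sup>2) has_sum 1) (insert z P)"
  shows "semidiscrete_parseval_frame (f z) P f"
proof -
  let ?I = "insert z P"
  have "conv_in_L2 h (f z) \<and> (\<forall>p\<in>P. conv_in_L2 h (f p)) \<and>
     (\<lambda>p. (L2_norm (conv h (f p)))\<^sup>2) summable_on P \<and>
     (L2_norm (conv h (f z)))\<^sup>2 + (\<Sum>\<^sub>\<infinity>p\<in>P. (L2_norm (conv h (f p)))\<^sup>2) = (L2_norm h)\<^sup>2"
    if h: "in_L2 h" for h :: "real^'n \<Rightarrow> complex"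
  proof -
    have hm: "h \<in> borel_measurable lebesgue"
      using h by (simp add: in_L2_def)
    obtain h' where h'm[measurable]: "h' \<in> borel_measurable borel" and h': "AE x in lebesgue. h x = h' x"
      using lebesgue_measurable_AE_eq_borel[OF hm] .
    note h'l = borel_imp_lebesgue_measurable[OF h'm]
    have h'2: "in_L2 h'" and norm_eq: "L2_norm h = L2_norm h'"
    proof -
      have ae: "AE x in lebesgue. (norm (h x))\<^sup>2 = (norm (h' x))\<^sup>2"
        using h' by eventually_elim simp
      have m: "(\<lambda>x. (norm (h x))\<^sup>2) \<in> borel_measurable lebesgue" "(\<lambda>x. (norm (h' x))\<^sup>2) \<in> borel_measurable lebesgue"
        using hm h'l by simp_all
      show "in_L2 h'"
        using h integrable_cong_AE[OF m ae] h'l by (simp add: in_L2_def)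
      show "L2_norm h = L2_norm h'"
        unfolding L2_norm_def using integral_cong_AE[OF m ae] by simp
    qed
    then have h'2': "integrable lborel (\<lambda>x. (norm (h' x))\<^sup>2)"
      by (simp add: in_L2_borel_iff)
    \<comment> \<open>For each fixed \<open>x\<close> the two integrands differ only on a null set
      of \<open>y\<close>, so the convolutions agree at every point and not merely almost
      everywhere.\<close>
    have conv: "AE x in lebesgue. integrable lebesgue (\<lambda>y. h y * f p (x - y))" "conv h (f p) = conv h' (f p)"
      if p: "p \<in> ?I" for p
    proof -
      note [measurable] = fm[OF p]
      have ae: "AE y in lebesgue. h y * f p (x - y) = h' y * f p (x - y)" for x
        using h' by eventually_elim simp
      have "(\<lambda>y. f p (x - y)) \<in> borel_measurable lebesgue" for x
        by (rule borel_imp_lebesgue_measurable) simp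
      then have m: "(\<lambda>y. h y * f p (x - y)) \<in> borel_measurable lebesgue"
        "(\<lambda>y. h' y * f p (x - y)) \<in> borel_measurable lebesgue" for x
        using hm h'l by simp_all
      have "integrable lebesgue (\<lambda>y. h' y * f p (x - y))" for x
        using integrable_conv_integrand[OF h'm fm[OF p] h'2'] f2[OF p] by (simp add: integrable_completion in_L2_borel_iff)
      then show "AE x in lebesgue. integrable lebesgue (\<lambda>y. h y * f p (x - y))"
        using integrable_cong_AE[OF m ae] by simp
      show "conv h (f p) = conv h' (f p)"
        using integral_cong_AE[OF m ae] by (simp add: conv_def fun_eq_iff)
    qed
    have sum: "(\<integral>\<^sup>+p. \<integral>\<^sup>+x. ennreal ((norm (conv h' (f p) x))\<^sup>2) \<partial>lborel \<partial>count_space ?I)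
        = (\<integral>\<^sup>+x. ennreal ((norm (h' x))\<^sup>2) \<partial>lborel)"
    proof (rule nn_integral_conv_family)
      show "integrable lborel (f p)" "integrable lborel (\<lambda>x. (norm (f p x))\<^sup>2)" if "p \<in> ?I" for p
        using f1[OF that] f2[OF that] fm[OF that] by (simp_all add: in_L1_borel_iff in_L2_borel_iff)
      show "(\<integral>\<^sup>+p. ennreal ((norm (fourier (f p) \<xi>))\<^sup>2) \<partial>count_space ?I) = 1" for \<xi>
        using nn_integral_count_space_eq_ennreal_iff[of ?I "\<lambda>p. (norm (fourier (f p) \<xi>))\<^sup>2" 1] partition by simp
    qed (use \<open>countable P\<close> h'2' in simp_all)
    have convm[measurable]: "conv h' (f p) \<in> borel_measurable borel" if "p \<in> ?I" for p
      by (rule borel_measurable_conv[OF h'm fm[OF that]])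
    \<comment> \<open>One convolution carries at most the energy of the whole family, which
      \<open>sum\<close> shows to be finite.\<close>
    have conv2: "in_L2 (conv h' (f p))" if p: "p \<in> ?I" for p
    proof -
      note [measurable] = convm[OF p]
      have "(\<integral>\<^sup>+x. ennreal ((norm (conv h' (f p) x))\<^sup>2) \<partial>lborel) \<le> (\<integral>\<^sup>+x. ennreal ((norm (h' x))\<^sup>2) \<partial>lborel)"
        unfolding sum[symmetric] by (rule nn_integral_ge_point[OF p])
      also have "\<dots> < \<infinity>"
        using h'2' by (simp add: integrable_iff_bounded)
      finally show ?thesis
        by (simp add: in_L2_borel_iff integrable_iff_bounded)
    qed
    have "(\<integral>\<^sup>+p. ennreal ((L2_norm (conv h (f p)))\<^sup>2) \<partial>count_space ?I) = ennreal ((L2_norm h)\<^sup>2)"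
      unfolding norm_eq ennreal_L2_norm_square[OF h'm h'2] sum[symmetric]
      by (rule nn_integral_cong) (simp add: conv ennreal_L2_norm_square convm conv2)
    then have "((\<lambda>p. (L2_norm (conv h (f p)))\<^sup>2) has_sum (L2_norm h)\<^sup>2) ?I"
      by (subst (asm) nn_integral_count_space_eq_ennreal_iff) simp_all
    from has_sum_insertD[OF this z] show ?thesis
      using conv conv2 by (simp add: conv_in_L2_def)
  qed
  then show ?thesis
    unfolding semidiscrete_parseval_frame_def by blast
qed

lemma semidiscrete_parseval_frame_cong:
  assumes "\<And>p. p \<in> P \<Longrightarrow> f p = f' p"
  shows "semidiscrete_parseval_frame f0 P f \<longleftrightarrow> semidiscrete_parseval_frame f0 P f'"
  using assms unfolding semidiscrete_parseval_frame_def
  by (simp cong: summable_on_cong infsum_cong ball_cong)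

subsection \<open>Essential supports, modulations and lattices\<close>

lemma AE_lebesgue_iff_negligible:
  "(AE x in lebesgue. Q x) \<longleftrightarrow> negligible {x. \<not> Q x}"
  unfolding eventually_ae_filter Bex_def negligible_iff_null_sets[symmetric]
  by (auto intro: negligible_subset)

lemma mem_ess_support_iff:
  "x \<in> ess_support u \<longleftrightarrow> (\<forall>U. open U \<longrightarrow> x \<in> U \<longrightarrow> \<not> negligible {y \<in> U. u y \<noteq> 0})"
  unfolding ess_support_def by (auto simp: AE_lebesgue_iff_negligible)

text \<open>Differentiable maps of the space into itself send null sets to null sets; this is
  applied to the affine map and to its inverse.\<close>

lemma negligible_affine_image_iff:
  fixes M :: "real^'n^'n"
  assumes "invertible M"
  shows "negligible ((\<lambda>x. M *v x + p) ` S) \<longleftrightarrow> negligible S"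
proof -
  have neg: "negligible ((\<lambda>x. N *v x + q) ` T)" if "negligible T" for N :: "real^'n^'n" and q T
    using that
    by (intro negligible_differentiable_image_negligible differentiable_at_imp_differentiable_on
        differentiable_add differentiable_const linear_imp_differentiable matrix_vector_mul_linear) auto
  obtain N where N: "N ** M = mat 1"
    using assms unfolding invertible_def by blast
  have "(\<lambda>x. N *v x + - (N *v p)) ` (\<lambda>x. M *v x + p) ` S = S"
    by (simp add: image_image matrix_vector_mul_assoc N matrix_vector_right_distrib)
  then show ?thesis
    using neg[of S M p] neg[of "(\<lambda>x. M *v x + p) ` S" N "- (N *v p)"] by auto
qed

lemma continuous_on_affine_matrix: "continuous_on X (\<lambda>x. (M :: real^'n^'m) *v x + p)"
  by (intro continuous_intros linear_continuous_on_compose matrix_vector_mul_linear continuous_on_id)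

text \<open>The essential support depends only on the open sets and the null sets, and an invertible
  affine map and its inverse preserve both.\<close>

lemma ess_support_affine:
  fixes M :: "real^'n^'n"
  assumes M: "invertible M" and uv: "\<And>x. u (M *v x + p) = v x"
  shows "ess_support u = (\<lambda>x. M *v x + p) ` ess_support v"
proof -
  let ?S = "\<lambda>x. M *v x + p"
  obtain N where N: "N ** M = mat 1" "M ** N = mat 1"
    using M unfolding invertible_def by blast
  let ?T = "\<lambda>y. N *v y + - (N *v p)"
  have ST: "?S (?T y) = y" "?T (?S x) = x" for x y
    by (simp_all add: matrix_vector_mul_assoc N matrix_vector_right_distrib matrix_vector_mult_diff_distrib)
  have image: "{y \<in> U. u y \<noteq> 0} = ?S ` {x \<in> ?S -` U. v x \<noteq> 0}" for U
  proof (intro set_eqI iffI)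
    fix y assume "y \<in> {y \<in> U. u y \<noteq> 0}"
    then have "?T y \<in> {x \<in> ?S -` U. v x \<noteq> 0}"
      using uv[of "?T y"] by (simp only: vimage_eq mem_Collect_eq ST(1)) simp
    then have "?S (?T y) \<in> ?S ` {x \<in> ?S -` U. v x \<noteq> 0}"
      by (rule imageI)
    then show "y \<in> ?S ` {x \<in> ?S -` U. v x \<noteq> 0}"
      unfolding ST(1) .
  qed (auto simp: uv)
  have "?S x \<in> ess_support u \<longleftrightarrow> x \<in> ess_support v" for x
  proof -
    have "?S x \<in> ess_support u \<longleftrightarrow> (\<forall>U. open U \<longrightarrow> ?S x \<in> U \<longrightarrow> \<not> negligible {x \<in> ?S -` U. v x \<noteq> 0})"
      unfolding mem_ess_support_iff image negligible_affine_image_iff[OF M] ..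
    also have "\<dots> \<longleftrightarrow> (\<forall>V. open V \<longrightarrow> x \<in> V \<longrightarrow> \<not> negligible {x \<in> V. v x \<noteq> 0})"
    proof (intro iffI allI impI)
      fix V assume all: "\<forall>U. open U \<longrightarrow> ?S x \<in> U \<longrightarrow> \<not> negligible {x \<in> ?S -` U. v x \<noteq> 0}"
        and V: "open V" "x \<in> V"
      have "open (?T -` V)"
        using V by (intro open_vimage continuous_on_affine_matrix)
      moreover have "?S x \<in> ?T -` V"
        using V by (simp only: vimage_eq ST)
      ultimately have "\<not> negligible {x \<in> ?S -` ?T -` V. v x \<noteq> 0}"
        using all by blast
      then show "\<not> negligible {x \<in> V. v x \<noteq> 0}"
        unfolding vimage_def mem_Collect_eq ST .
    next
      fix U assume all: "\<forall>V. open V \<longrightarrow> x \<in> V \<longrightarrow> \<not> negligible {x \<in> V. v x \<noteq> 0}"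
        and U: "open U" "?S x \<in> U"
      have "open (?S -` U)" "x \<in> ?S -` U"
        using U by (auto intro: open_vimage continuous_on_affine_matrix)
      then show "\<not> negligible {x \<in> ?S -` U. v x \<noteq> 0}"
        using all by blast
    qed
    also have "\<dots> \<longleftrightarrow> x \<in> ess_support v"
      unfolding mem_ess_support_iff ..
    finally show ?thesis .
  qed
  then show ?thesis
    using ST(1) by (metis (no_types, lifting) image_iff subsetI subset_antisym)
qed

text \<open>The integrands coincide pointwise, so the identity holds for every \<open>h\<close>,
  integrable or not.\<close>

lemma fourier_modulation: "fourier (modulation p h) \<xi> = fourier h (\<xi> - p)"
proof -
  have eq: "cis (2 * pi * (p \<bullet> x)) * h x * cis (- 2 * pi * (x \<bullet> \<xi>)) = h x * cis (- 2 * pi * (x \<bullet> (\<xi> - p)))" for x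
  proof -
    have "cis (2 * pi * (p \<bullet> x)) * cis (- 2 * pi * (x \<bullet> \<xi>)) = cis (- 2 * pi * (x \<bullet> (\<xi> - p)))"
      by (simp add: cis_mult inner_diff_right inner_commute[of p] right_diff_distrib)
    then show ?thesis
      by (metis mult.assoc mult.commute)
  qed
  show ?thesis
    unfolding fourier_def modulation_def eq by (rule refl)
qed

lemma norm_modulation: "norm (modulation p h x) = norm (h x)"
  by (simp add: modulation_def norm_mult)

lemma borel_measurable_modulation:
  "h \<in> borel_measurable borel \<Longrightarrow> modulation p h \<in> borel_measurable borel"
  unfolding modulation_def[abs_def] by measurable

lemma in_L1_modulation:
  assumes [measurable]: "h \<in> borel_measurable borel" and "in_L1 h"
  shows "in_L1 (modulation p h)"
  using assms integrable_mult_cis[of lborel h "\<lambda>x. 2 * pi * (p \<bullet> x)"]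
  by (simp add: in_L1_borel_iff borel_measurable_modulation modulation_def[abs_def] mult.commute)

lemma in_L2_modulation:
  "h \<in> borel_measurable borel \<Longrightarrow> in_L2 h \<Longrightarrow> in_L2 (modulation p h)"
  by (simp add: in_L2_borel_iff borel_measurable_modulation norm_modulation)

lemma modulation_0: "modulation 0 h = h"
  by (simp add: modulation_def fun_eq_iff)

lemma borel_measurable_in_C1: "in_C1 g \<Longrightarrow> g \<in> borel_measurable borel"
  unfolding in_C1_def
  by (auto intro!: borel_measurable_continuous_onI continuous_at_imp_continuous_on dest: has_derivative_continuous)

lemma in_C1_linear_compose:
  fixes A :: "real^'n \<Rightarrow> real^'n"
  assumes "in_C1 g" and "linear A"
  shows "in_C1 (\<lambda>x. complex_of_real c * g (A x))"
proof -
  obtain g' where g': "\<And>x. (g has_derivative blinfun_apply (g' x)) (at x)" "continuous_on UNIV g'"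
    using assms(1) unfolding in_C1_def by blast
  have A: "bounded_linear A"
    using assms(2) by (simp add: linear_conv_bounded_linear)
  let ?f' = "\<lambda>x. c *\<^sub>R (g' (A x) o\<^sub>L Blinfun A)"
  have "((\<lambda>x. complex_of_real c * g (A x)) has_derivative blinfun_apply (?f' x)) (at x)" for x
  proof -
    have "((\<lambda>x. g (A x)) has_derivative (\<lambda>v. blinfun_apply (g' (A x)) (A v))) (at x)"
      using has_derivative_compose[OF bounded_linear_imp_has_derivative[OF A] g'(1)] .
    then have "((\<lambda>x. c *\<^sub>R g (A x)) has_derivative (\<lambda>v. c *\<^sub>R blinfun_apply (g' (A x)) (A v))) (at x)"
      by (rule has_derivative_scaleR_right)
    moreover have "blinfun_apply (?f' x) = (\<lambda>v. c *\<^sub>R blinfun_apply (g' (A x)) (A v))"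
      by (simp add: fun_eq_iff blinfun.scaleR_left bounded_linear_Blinfun_apply[OF A])
    ultimately show ?thesis
      by (simp add: scaleR_conv_of_real)
  qed
  moreover have "continuous_on UNIV ?f'"
    using continuous_on_compose2[OF g'(2) linear_continuous_on[OF A]]
    by (intro continuous_intros bounded_bilinear.continuous_on[OF bounded_bilinear_blinfun_compose]) auto
  ultimately show ?thesis
    unfolding in_C1_def by (intro exI[of _ ?f'] conjI allI)
qed

section \<open>Lattices and translated cube covers\<close>

lemma countable_int_lattice: "countable (int_lattice :: (real^'n) set)"
proof -
  have "int_lattice \<subseteq> range (\<lambda>k :: 'n \<Rightarrow> int. (\<chi> i. of_int (k i)) :: real^'n)"
  proof
    fix m :: "real^'n" assume "m \<in> int_lattice"
    then have "\<forall>i. \<exists>k. m $ i = of_int k"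
      by (auto simp: int_lattice_def elim: Ints_cases)
    then obtain k where "\<And>i. m $ i = of_int (k i)"
      by metis
    then show "m \<in> range (\<lambda>k :: 'n \<Rightarrow> int. (\<chi> i. of_int (k i)) :: real^'n)"
      by (intro image_eqI[of _ _ k]) (auto simp: vec_eq_iff)
  qed
  then show ?thesis
    by (rule countable_subset) simp
qed

lemma infinite_int_lattice: "infinite (int_lattice :: (real^'n) set)"
proof (rule infinite_super)
  let ?e = "\<lambda>k :: nat. axis undefined (real k) :: real^'n"
  show "range ?e \<subseteq> int_lattice"
    by (auto simp: int_lattice_def axis_def)
  have "inj ?e"
    by (auto intro!: injI simp: axis_eq_axis)
  then show "infinite (range ?e)"
    by (rule range_inj_infinite)
qed

text \<open>The columns of \<open>M\<close>, that is the images of the standard basis, serve as the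
  lattice basis.\<close>

lemma is_lattice_image_int_lattice:
  fixes M :: "real^'n^'n"
  assumes M: "invertible M"
  shows "is_lattice ((*v) M ` int_lattice)"
proof -
  let ?B = "(*v) M ` Basis"
  have inj: "inj ((*v) M)"
    by (rule inj_matrix_vector_mult[OF M])
  have lin: "linear ((*v) M)"
    by (rule matrix_vector_mul_linear)
  have indep: "independent ?B"
    using lin inj independent_Basis by (intro linear_independent_injective_image) (auto intro: inj_on_subset)
  have "surj ((*v) M)"
    by (rule linear_inj_imp_surj[OF lin inj])
  then have span: "span ?B = UNIV"
    unfolding linear_span_image[OF lin] span_Basis .
  have sum: "(\<Sum>b\<in>?B. of_int (c b) *\<^sub>R b) = M *v (\<Sum>b\<in>Basis. of_int (c (M *v b)) *\<^sub>R b)" for c :: "real^'n \<Rightarrow> int"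
    using inj by (subst sum.reindex) (auto simp: linear_sum[OF lin] linear_scale[OF lin] intro: inj_on_subset)
  have "(*v) M ` int_lattice = range (\<lambda>c :: real^'n \<Rightarrow> int. \<Sum>b\<in>?B. of_int (c b) *\<^sub>R b)"
  proof (intro set_eqI iffI)
    fix y assume "y \<in> (*v) M ` int_lattice"
    then obtain m where m: "m \<in> int_lattice" "y = M *v m" by blast
    \<comment> \<open>Coefficients are indexed by the vectors of \<open>?B\<close>:
      \<open>inv\<close> recovers the standard basis vector behind \<open>b\<close>, and the floor
      only converts a coordinate of \<open>m\<close>, already an integer, to type
      \<open>int\<close>.\<close>
    define c where "c b = \<lfloor>m \<bullet> inv ((*v) M) b\<rfloor>" for b
    have "of_int (c (M *v b)) = m \<bullet> b" if "b \<in> Basis" for b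
      using m(1) that inj by (auto simp: c_def int_lattice_def Basis_vec_def inner_axis) (metis Ints_cases)
    then have "(\<Sum>b\<in>?B. of_int (c b) *\<^sub>R b) = y"
      unfolding sum m(2) by (simp add: euclidean_representation cong: sum.cong)
    then show "y \<in> range (\<lambda>c :: real^'n \<Rightarrow> int. \<Sum>b\<in>?B. of_int (c b) *\<^sub>R b)"
      by blast
  next
    fix y assume "y \<in> range (\<lambda>c :: real^'n \<Rightarrow> int. \<Sum>b\<in>?B. of_int (c b) *\<^sub>R b)"
    then obtain c where y: "y = M *v (\<Sum>b\<in>Basis. of_int (c (M *v b)) *\<^sub>R b)"
      unfolding sum by blast
    have "(\<Sum>b\<in>Basis. of_int (c (M *v b)) *\<^sub>R b) $ i \<in> \<int>" for i
      by (auto simp: Basis_vec_def axis_def sum_component intro!: Ints_sum)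
    then show "y \<in> (*v) M ` int_lattice"
      unfolding y int_lattice_def by blast
  qed
  then show ?thesis
    unfolding is_lattice_def using indep span by blast
qed

text \<open>A finite subcover of \<open>K\<close> is chosen once and moved along with
  \<open>p\<close>, so the number of cubes is fixed before \<open>p\<close>; this is the uniformity
  in the covering property.\<close>

lemma compact_cube_cover:
  assumes "compact (K :: (real^'n) set)" and "R > 0"
  obtains N :: nat and x where "N > 0" and "\<forall>p. (\<lambda>y. y + p) ` K \<subseteq> (\<Union>i<N. cube R (x i + p))"
proof -
  have "open (cube R y)" for y :: "real^'n"
    unfolding cube_def by (intro open_Collect_less continuous_intros)
  moreover have "K \<subseteq> (\<Union>y\<in>K. cube R y)"
    using \<open>R > 0\<close> by (auto simp: cube_def infnorm_0)
  ultimately obtain C where C: "finite C" "K \<subseteq> (\<Union>y\<in>C. cube R y)"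
    using compactE_image[OF assms(1), of K "cube R"] by metis
  obtain x where x: "bij_betw x {0..<card C} C"
    using ex_bij_betw_nat_finite[OF C(1)] by blast
  \<comment> \<open>The additional cube, of arbitrary centre, keeps the number positive when
    \<open>K\<close> is empty.\<close>
  have "(\<lambda>y. y + p) ` K \<subseteq> (\<Union>i<card C + 1. cube R (x i + p))" for p
  proof
    fix w assume "w \<in> (\<lambda>y. y + p) ` K"
    then obtain y c where y: "w = y + p" "y \<in> cube R c" "c \<in> C"
      using C(2) by blast
    moreover obtain i where "i < card C" "c = x i"
      using x y(3) by (metis atLeastLessThan_iff bij_betw_imp_surj_on imageE)
    ultimately show "w \<in> (\<Union>i<card C + 1. cube R (x i + p))"
      by (auto simp: cube_def intro!: bexI[of _ i])
  qed
  then show ?thesis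
    using that[of "card C + 1" x] by simp
qed

theorem proposition2p3:
  fixes g f0 :: "real ^ 'n \<Rightarrow> complex"
    and A :: "real ^ 'n \<Rightarrow> real ^ 'n"
    and P :: "(real ^ 'n) set"
    and f :: "real ^ 'n \<Rightarrow> real ^ 'n \<Rightarrow> complex"
  assumes "in_L1 g" and "in_L2 g" and "in_C1 g"
    and "compact (ess_support (fourier g))" and "connected (ess_support (fourier g))"
    and "cmod (fourier g 0) = 1"
    and "\<And>\<xi>. ((\<lambda>m. (cmod (fourier g (\<xi> - m)))\<^sup>2) has_sum 1) int_lattice"
    and "linear A" and "bij A"
    and "f0 = (\<lambda>x. complex_of_real \<bar>det (matrix A)\<bar> * g (A x))"
    and "P = (\<lambda>m. transpose (matrix A) *v m) ` int_lattice - {0}"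
    and "\<And>p. p \<in> P \<Longrightarrow> f p = modulation p f0"
  shows "gabor_frame f0 P f \<and> uniform_covering_frame f0 P f"
proof -
  note f0_def = assms(10) and P_def = assms(11) and f_def = assms(12)
  define M where "M = transpose (matrix A)"
  define \<Lambda> where "\<Lambda> = (*v) M ` int_lattice"
  have det: "det (matrix A) \<noteq> 0"
    using det_nz_iff_inj[OF \<open>linear A\<close>] \<open>bij A\<close> by (simp add: bij_is_inj)
  then have M: "invertible M"
    by (simp add: M_def invertible_det_nz)
  have injM: "inj ((*v) M)"
    by (rule inj_matrix_vector_mult[OF M])
  have "(0 :: real^'n) \<in> int_lattice"
    by (simp add: int_lattice_def)
  then have "0 \<in> \<Lambda>"
    unfolding \<Lambda>_def by (intro image_eqI[of _ _ 0]) auto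
  \<comment> \<open>With 0 restored the index set is the full lattice, over which the partition of
    unity is stated.\<close>
  then have P: "P = \<Lambda> - {0}" "0 \<notin> P" "insert 0 P = \<Lambda>"
    by (auto simp: P_def \<Lambda>_def M_def)
  have gm[measurable]: "g \<in> borel_measurable borel"
    by (rule borel_measurable_in_C1[OF \<open>in_C1 g\<close>])
  note [measurable] = borel_measurable_linear[OF \<open>linear A\<close>]
  have f0m[measurable]: "f0 \<in> borel_measurable borel"
    unfolding f0_def by simp
  have f0_L1: "in_L1 f0"
    using \<open>in_L1 g\<close> integrable_lborel_linear[OF \<open>linear A\<close> det gm]
    by (simp add: in_L1_borel_iff f0m gm) (simp add: f0_def)
  have f0_L2: "in_L2 f0"
    using \<open>in_L2 g\<close> integrable_lborel_linear[OF \<open>linear A\<close> det, of "\<lambda>x. (norm (g x))\<^sup>2"]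
    by (simp add: in_L2_borel_iff f0m gm) (simp add: f0_def norm_mult power_mult_distrib)
  have f0_C1: "in_C1 f0"
    unfolding f0_def by (rule in_C1_linear_compose[OF \<open>in_C1 g\<close> \<open>linear A\<close>])
  have inner: "x \<bullet> (M *v \<eta>) = A x \<bullet> \<eta>" for x \<eta>
  proof -
    have "x \<bullet> (M *v \<eta>) = (\<eta> v* matrix A) \<bullet> x"
      by (simp add: M_def inner_commute)
    also have "\<dots> = \<eta> \<bullet> A x"
      using \<open>linear A\<close> by (simp add: dot_lmul_matrix)
    finally show ?thesis
      by (simp add: inner_commute)
  qed
  \<comment> \<open>The determinant factor in \<open>f0\<close> is exactly the Jacobian of the
    substitution by \<open>A\<close>, and by \<open>inner\<close> the transpose in \<open>M\<close>
    moves \<open>A\<close> to the other side of the inner product.\<close>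
  have f0_hat: "fourier f0 (M *v \<eta>) = fourier g \<eta>" for \<eta>
  proof -
    have "fourier g \<eta> = \<bar>det (matrix A)\<bar> *\<^sub>R (LINT x|lborel. g (A x) * cis (- 2 * pi * (A x \<bullet> \<eta>)))"
      unfolding fourier_lborel[OF gm] by (rule integral_lborel_linear[OF \<open>linear A\<close> det]) simp
    also have "\<dots> = fourier f0 (M *v \<eta>)"
      unfolding fourier_lborel[OF f0m] inner
      by (simp add: f0_def scaleR_conv_of_real mult.assoc)
    finally show ?thesis ..
  qed
  have hat: "fourier (modulation p f0) (M *v \<eta> + p) = fourier g \<eta>" for p \<eta>
    by (simp add: fourier_modulation f0_hat)
  have supp: "ess_support (fourier (modulation p f0)) = (\<lambda>x. M *v x + p) ` ess_support (fourier g)" for p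
    by (rule ess_support_affine[OF M]) (rule hat)
  \<comment> \<open>Compared with the window's own support the linear part drops out and a pure
    translation is left, so one cover of that support serves all \<open>p\<close>.\<close>
  have supp0: "ess_support (fourier (modulation p f0)) = (\<lambda>y. y + p) ` ess_support (fourier f0)" for p
    using supp[of p] supp[of 0] by (simp add: modulation_0 image_image)
  have compact: "compact (ess_support (fourier (modulation p f0)))" for p
    unfolding supp by (rule compact_continuous_image[OF continuous_on_affine_matrix assms(4)])
  have connected: "connected (ess_support (fourier (modulation p f0)))" for p
    unfolding supp by (rule connected_continuous_image[OF continuous_on_affine_matrix assms(5)])
  have partition: "((\<lambda>p. (cmod (fourier (modulation p f0) \<xi>))\<^sup>2) has_sum 1) \<Lambda>" for \<xi>
  proof -
    obtain N where "M ** N = mat 1"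
      using M unfolding invertible_def by blast
    \<comment> \<open>Every frequency has the form \<open>M *v \<eta>\<close>; subtracting the
      lattice point \<open>M *v m\<close> then amounts to the integer shift
      \<open>\<eta> - m\<close> in the hypothesis on \<open>g\<close>.\<close>
    then have \<xi>: "\<xi> = M *v (N *v \<xi>)"
      by (simp add: matrix_vector_mul_assoc)
    have "fourier (modulation (M *v m) f0) \<xi> = fourier g (N *v \<xi> - m)" for m
      by (subst \<xi>) (simp add: fourier_modulation f0_hat flip: matrix_vector_mult_diff_distrib)
    then show ?thesis
      unfolding \<Lambda>_def using assms(7)[of "N *v \<xi>"]
      by (subst has_sum_reindex) (auto simp: o_def intro: inj_on_subset[OF injM])
  qed
  have countable: "countable P"
    unfolding P(1) \<Lambda>_def by (intro countable_Diff countable_image countable_int_lattice)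
  have infinite: "infinite P"
    using infinite_int_lattice finite_imageD[of "(*v) M" int_lattice] injM
    unfolding P(1) \<Lambda>_def by (auto intro: inj_on_subset)
  \<comment> \<open>\<open>f\<close> is specified on \<open>P\<close> only and \<open>f 0\<close>
    may be anything. The criterion is therefore applied to
    \<open>\<lambda>p. modulation p f0\<close>, with index 0 as the window, and the result is
    carried over by congruence.\<close>
  have "semidiscrete_parseval_frame (modulation 0 f0) P (\<lambda>p. modulation p f0)"
    by (rule semidiscrete_parseval_frameI[OF countable P(2)])
       (simp_all only: P(3) partition borel_measurable_modulation in_L1_modulation in_L2_modulation f0m f0_L1 f0_L2)
  then have "semidiscrete_parseval_frame f0 P f"
    using semidiscrete_parseval_frame_cong[of P f "\<lambda>p. modulation p f0" f0] f_def by (simp add: modulation_0)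
  moreover have "is_lattice \<Lambda>"
    unfolding \<Lambda>_def by (rule is_lattice_image_int_lattice[OF M])
  ultimately have gabor: "gabor_frame f0 P f"
    unfolding gabor_frame_def using P(1) f_def by blast
  have covering: "uniform_covering_property P f"
    unfolding uniform_covering_property_def
  proof (intro allI impI)
    fix R :: real assume "R > 0"
    obtain N :: nat and x where "N > 0"
      and cover: "\<forall>p. (\<lambda>y. y + p) ` ess_support (fourier f0) \<subseteq> (\<Union>i<N. cube R (x i + p))"
      by (rule compact_cube_cover[OF compact[of 0, unfolded modulation_0] \<open>R > 0\<close>])
    show "\<exists>N::nat. N > 0 \<and> (\<forall>p\<in>P. \<exists>x :: nat \<Rightarrow> real ^ 'n. ess_support (fourier (f p)) \<subseteq> (\<Union>i<N. cube R (x i)))"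
    proof (intro exI[of _ N] conjI ballI)
      fix p assume "p \<in> P"
      show "\<exists>x :: nat \<Rightarrow> real ^ 'n. ess_support (fourier (f p)) \<subseteq> (\<Union>i<N. cube R (x i))"
        unfolding f_def[OF \<open>p \<in> P\<close>] supp0[of p] by (rule exI) (rule cover[rule_format])
    qed (fact \<open>N > 0\<close>)
  qed
  have frame: "frame_condition f0 P f"
    unfolding frame_condition_def
  proof
    fix \<xi>
    have "((\<lambda>p. (cmod (fourier (modulation p f0) \<xi>))\<^sup>2) has_sum 1) (insert 0 P)"
      unfolding P(3) by (rule partition)
    from has_sum_insertD[OF this P(2)]
    show "(\<lambda>p. (cmod (fourier (f p) \<xi>))\<^sup>2) summable_on P \<and>
        (cmod (fourier f0 \<xi>))\<^sup>2 + (\<Sum>\<^sub>\<infinity>p\<in>P. (cmod (fourier (f p) \<xi>))\<^sup>2) = 1"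
      by (simp add: modulation_0 f_def cong: summable_on_cong infsum_cong)
  qed
  obtain r where "\<And>x. x \<in> ess_support (fourier f0) \<Longrightarrow> norm x \<le> r"
    using compact_imp_bounded[OF compact[of 0]] unfolding modulation_0 bounded_iff by blast
  \<comment> \<open>The radius \<open>max r 1\<close> keeps 0 in the interior for every value of
    \<open>r\<close>.\<close>
  then have nbhd: "\<exists>K. compact K \<and> 0 \<in> interior K \<and> ess_support (fourier f0) \<subseteq> K"
    by (intro exI[of _ "cball 0 (max r 1)"]) (auto simp: interior_cball le_max_iff_disj)
  have "cmod (fourier f0 0) = 1"
    using f0_hat[of 0] assms(6) by simp
  then have "uniform_covering_frame f0 P f"
    unfolding uniform_covering_frame_def
    using countable infinite f0_L1 f0_L2 f0_C1 nbhd covering frame compact connected f_def f0m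
    by (auto intro: in_L1_modulation in_L2_modulation)
  with gabor show ?thesis by blast
qed

end
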